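(* Let $M$ be a matroid with a basis $B_0$ and fundamental circuits $\mathcal C=(C_i)_{i\in R}$, $R=E\setminus B_0$. (a) If $\mathcal C$ is a cycle system, then there are no dead strata, the empty fibre system $F$ is the only fibre system on $(M,B_0)$, and $\mathcal P^*(F)=\mathcal P^*(\mathcal C)$ is the set of coparking functions of $\mathcal C$. (b) If $\mathcal C$ is a generalized cycle system, then $(M,B_0)$ carries a unique fibre system $F$ (namely $F(\sigma)=\{0\}$ at every dead stratum $\sigma$), and $$\mathcal P^*(F)=\{a\in\mathbb N^R:\ \text{no live stratum can be fired from }a,\ \text{and } a|_\tau=b_\tau\text{ for every dead stratum }\tau\text{ that can be fired from }a\}.$$ In both cases $\mathcal P^*(F)$ is a pure multicomplex with degree sequence $h(M)$.
   Context: $M$ is a matroid on a finite ground set $E$ with rank function $r$ and fixed basis $B_0$; $R=E\setminus B_0$. For $i\in R$, $C_i$ is the fundamental circuit of $i$, the unique circuit contained in $B_0\cup\{i\}$. For $\sigma\subseteq R$ put $m_\sigma(e)=\#\{i\in\sigma: e\in C_i\}$, $U_\sigma=\{e: m_\sigma(e)=1\}$, $A_\sigma=\{e: m_\sigma(e)\ge1\}=\bigcup_{i\in\sigma}C_i$. A cycle of $M$ is a union of circuits. A collection $\{C_1,\dots,C_g\}$ of $g$ cycles, $g$ the corank of $M$, is a cycle system if for every nonempty $S\subseteq[g]$ the set $U_S$ of elements lying in exactly one $C_i$ with $i\in S$ is dependent; it is a generalized cycle system if for every nonempty $S$ the set $U_S$ is either dependent or a basis of the restriction $M|\bigcup_{i\in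 S}C_i$. (The fundamental circuits of a basis form a collection of $g$ circuits.) A stratum is a nonempty $\sigma\subseteq R$; it is dead if $U_\sigma$ is independent in $M$, live otherwise. The baseline $b_\sigma\in\mathbb N^\sigma$ is $b_\sigma(i)=|C_i\cap U_\sigma|$; $\mathbb N^\sigma$ is identified with the vectors in $\mathbb N^R$ vanishing outside $\sigma$. $\sigma$ can be fired from $a\in\mathbb N^R$ if $a_i\ge b_\sigma(i)$ for all $i\in\sigma$. The set $\mathcal P^*(\mathcal C)$ of coparking functions is the set of $a\in\mathbb N^R$ from which no stratum can be fired. For dead $\sigma$, $K_\sigma=(M|A_\sigma)/U_\sigma$. For a matroid $N$ of rank $d$, $h(N)=(h_0,\dots,h_d)$ is the $h$-vector of its independence complex: $T_N(x,1)=\sum_kh_kx^{d-k}$. A multicomplex is a finite set of monomials (exponent vectors) closed under division; it is pure if all maximal elements have the same degree $|a|=\sum a_i$; its degree sequence counts elements of each degree (trailing zeros ignored). Fibres (recursively along inclusion): given fibres $F(\tau)$ at all dead $\tau\subsetneq\sigma$, a fibre at a dead stratum $\sigma$ is a set $F(\sigma)\subseteq\mathbb N^\sigma$ such that (i) $F(\sigma)$ is a pure multicomplex with degree sequence $h(K_\sigma)$; (ii) for every $m\in F(\sigma)$, every stratum $\tau\subsetneq\sigma$ that can be fired from $b_\sigma+m$ is dead with $(b_\sigma+m)|_\tau-b_\tau\in F(\tau)$. A fibre system $F$ on $(M,B_0)$ is a choice of a fibre at every dead stratum. $\mathcal P^*(F)$ is the set of $a\in\mathbb N^R$ such that every stratum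 $\tau$ that can be fired from $a$ is dead with $a|_\tau-b_\tau\in F(\tau)$. *)

theory Defs
  imports "HOL-Computational_Algebra.Polynomial"
begin

section \<open>Matroids\<close>

record 'a matroid_data =
  ground :: "'a set"
  indeps :: "'a set set"

locale matroid =
  fixes M :: "'a matroid_data"
  assumes finite_ground: "finite (ground M)"
    and indeps_subset: "X \<in> indeps M \<Longrightarrow> X \<subseteq> ground M"
    and empty_indep: "{} \<in> indeps M"
    and indep_mono: "\<lbrakk>X \<in> indeps M; Y \<subseteq> X\<rbrakk> \<Longrightarrow> Y \<in> indeps M"
    and augment: "\<lbrakk>X \<in> indeps M; Y \<in> indeps M; card X < card Y\<rbrakk>
      \<Longrightarrow> \<exists>y \<in> Y - X. insert y X \<in> indeps M"

definition dependent :: "'a matroid_data \<Rightarrow> 'a set \<Rightarrow> bool" where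
  "dependent M X \<longleftrightarrow> X \<subseteq> ground M \<and> X \<notin> indeps M"

definition basis :: "'a matroid_data \<Rightarrow> 'a set \<Rightarrow> bool" where
  "basis M B \<longleftrightarrow> B \<in> indeps M \<and> (\<forall>X \<in> indeps M. B \<subseteq> X \<longrightarrow> X = B)"

definition circuit :: "'a matroid_data \<Rightarrow> 'a set \<Rightarrow> bool" where
  "circuit M C \<longleftrightarrow> dependent M C \<and> (\<forall>X. X \<subset> C \<longrightarrow> X \<in> indeps M)"

definition rank :: "'a matroid_data \<Rightarrow> 'a set \<Rightarrow> nat" where
  "rank M X = Max (card ` {Y \<in> indeps M. Y \<subseteq> X})"

definition corank :: "'a matroid_data \<Rightarrow> nat" where
  "corank M = card (ground M) - rank M (ground M)"

definition restriction :: "'a matroid_data \<Rightarrow> 'a set \<Rightarrow> 'a matroid_data" where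
  "restriction M A = \<lparr>ground = ground M \<inter> A, indeps = {X \<in> indeps M. X \<subseteq> A}\<rparr>"

text \<open>The rank function of the contraction is \<open>X \<mapsto> rank M (X \<union> T) - rank M T\<close>, and a set is
  independent when its rank is its cardinality.\<close>

definition contraction :: "'a matroid_data \<Rightarrow> 'a set \<Rightarrow> 'a matroid_data" where
  "contraction M T = \<lparr>ground = ground M - T,
     indeps = {X. X \<subseteq> ground M - T \<and> rank M (X \<union> T) = rank M T + card X}\<rparr>"

text \<open>The inner polynomials are in \<open>x\<close>, the outer variable is \<open>y\<close>; thus \<^term>\<open>[:[:-1, 1:]:]\<close> is
  \<open>x - 1\<close>, \<^term>\<open>[:-1, 1:]\<close> is \<open>y - 1\<close>, and evaluation at \<open>1\<close> yields \<open>T(x,1)\<close>.\<close>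

definition tutte :: "'a matroid_data \<Rightarrow> int poly poly" where
  "tutte M = (\<Sum>A \<in> Pow (ground M).
     [:[:-1, 1:]:] ^ (rank M (ground M) - rank M A) * [:-1, 1:] ^ (card A - rank M A))"

definition h_vector :: "'a matroid_data \<Rightarrow> nat \<Rightarrow> int" where
  "h_vector M k = (if k \<le> rank M (ground M)
     then coeff (poly (tutte M) 1) (rank M (ground M) - k) else 0)"


section \<open>Multicomplexes\<close>

text \<open>Exponent vectors in \<open>\<nat>\<^sup>V\<close> are total functions vanishing outside \<open>V\<close>, which builds in the
  inclusion of \<open>\<nat>\<^sup>\<sigma>\<close> in \<open>\<nat>\<^sup>V\<close> for \<open>\<sigma> \<subseteq> V\<close>.  Division of monomials is the pointwise order.\<close>

definition vectors :: "'i set \<Rightarrow> ('i \<Rightarrow> nat) set" where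
  "vectors V = {a. \<forall>i. i \<notin> V \<longrightarrow> a i = 0}"

definition restr :: "'i set \<Rightarrow> ('i \<Rightarrow> nat) \<Rightarrow> 'i \<Rightarrow> nat" where
  "restr V a = (\<lambda>i. if i \<in> V then a i else 0)"

definition vdegree :: "'i set \<Rightarrow> ('i \<Rightarrow> nat) \<Rightarrow> nat" where
  "vdegree V a = (\<Sum>i\<in>V. a i)"

definition multicomplex :: "'i set \<Rightarrow> ('i \<Rightarrow> nat) set \<Rightarrow> bool" where
  "multicomplex V Q \<longleftrightarrow> finite Q \<and> Q \<subseteq> vectors V \<and> (\<forall>a \<in> Q. \<forall>a'. a' \<le> a \<longrightarrow> a' \<in> Q)"

definition maximal_in :: "('i \<Rightarrow> nat) set \<Rightarrow> ('i \<Rightarrow> nat) \<Rightarrow> bool" where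
  "maximal_in Q a \<longleftrightarrow> a \<in> Q \<and> (\<forall>a' \<in> Q. a \<le> a' \<longrightarrow> a' = a)"

definition pure_multicomplex :: "'i set \<Rightarrow> ('i \<Rightarrow> nat) set \<Rightarrow> bool" where
  "pure_multicomplex V Q \<longleftrightarrow> multicomplex V Q \<and>
     (\<forall>a a'. maximal_in Q a \<longrightarrow> maximal_in Q a' \<longrightarrow> vdegree V a = vdegree V a')"

text \<open>Comparing with a sequence extended by zeros amounts to ignoring trailing zeros.\<close>

definition has_degree_sequence :: "'i set \<Rightarrow> ('i \<Rightarrow> nat) set \<Rightarrow> (nat \<Rightarrow> int) \<Rightarrow> bool" where
  "has_degree_sequence V Q h \<longleftrightarrow> (\<forall>k. int (card {a \<in> Q. vdegree V a = k}) = h k)"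


section \<open>Cycle systems and coparking functions of a family of sets\<close>

definition multiplicity_in :: "('i \<Rightarrow> 'a set) \<Rightarrow> 'i set \<Rightarrow> 'a \<Rightarrow> nat" where
  "multiplicity_in C \<sigma> e = card {i \<in> \<sigma>. e \<in> C i}"

definition U_set :: "('i \<Rightarrow> 'a set) \<Rightarrow> 'i set \<Rightarrow> 'a set" where
  "U_set C \<sigma> = {e. multiplicity_in C \<sigma> e = 1}"

definition A_set :: "('i \<Rightarrow> 'a set) \<Rightarrow> 'i set \<Rightarrow> 'a set" where
  "A_set C \<sigma> = (\<Union>i\<in>\<sigma>. C i)"

definition cycle :: "'a matroid_data \<Rightarrow> 'a set \<Rightarrow> bool" where
  "cycle M X \<longleftrightarrow> (\<exists>\<D>. (\<forall>D \<in> \<D>. circuit M D) \<and> X = \<Union>\<D>)"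

definition cycle_family :: "'a matroid_data \<Rightarrow> 'i set \<Rightarrow> ('i \<Rightarrow> 'a set) \<Rightarrow> bool" where
  "cycle_family M I C \<longleftrightarrow> finite I \<and> card I = corank M \<and> (\<forall>i \<in> I. cycle M (C i))"

definition cycle_system :: "'a matroid_data \<Rightarrow> 'i set \<Rightarrow> ('i \<Rightarrow> 'a set) \<Rightarrow> bool" where
  "cycle_system M I C \<longleftrightarrow> cycle_family M I C \<and>
     (\<forall>S. S \<noteq> {} \<and> S \<subseteq> I \<longrightarrow> dependent M (U_set C S))"

definition generalized_cycle_system :: "'a matroid_data \<Rightarrow> 'i set \<Rightarrow> ('i \<Rightarrow> 'a set) \<Rightarrow> bool" where
  "generalized_cycle_system M I C \<longleftrightarrow> cycle_family M I C \<and>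
     (\<forall>S. S \<noteq> {} \<and> S \<subseteq> I \<longrightarrow>
        dependent M (U_set C S) \<or> basis (restriction M (\<Union>i\<in>S. C i)) (U_set C S))"

definition stratum :: "'i set \<Rightarrow> 'i set \<Rightarrow> bool" where
  "stratum I \<sigma> \<longleftrightarrow> \<sigma> \<noteq> {} \<and> \<sigma> \<subseteq> I"

definition baseline :: "('i \<Rightarrow> 'a set) \<Rightarrow> 'i set \<Rightarrow> 'i \<Rightarrow> nat" where
  "baseline C \<sigma> = restr \<sigma> (\<lambda>i. card (C i \<inter> U_set C \<sigma>))"

definition can_fire :: "('i \<Rightarrow> 'a set) \<Rightarrow> 'i set \<Rightarrow> ('i \<Rightarrow> nat) \<Rightarrow> bool" where
  "can_fire C \<sigma> a \<longleftrightarrow> (\<forall>i \<in> \<sigma>. baseline C \<sigma> i \<le> a i)"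

definition coparking :: "'i set \<Rightarrow> ('i \<Rightarrow> 'a set) \<Rightarrow> ('i \<Rightarrow> nat) set" where
  "coparking I C = {a \<in> vectors I. \<forall>\<sigma>. stratum I \<sigma> \<longrightarrow> \<not> can_fire C \<sigma> a}"


section \<open>Fibre systems of a matroid with a basis\<close>

definition fund_circuit :: "'a matroid_data \<Rightarrow> 'a set \<Rightarrow> 'a \<Rightarrow> 'a set" where
  "fund_circuit M B i = (THE C. circuit M C \<and> C \<subseteq> insert i B)"

definition dead_strata :: "'a matroid_data \<Rightarrow> 'a set \<Rightarrow> 'a set set" where
  "dead_strata M B =
     {\<sigma>. stratum (ground M - B) \<sigma> \<and> U_set (fund_circuit M B) \<sigma> \<in> indeps M}"

definition live_strata :: "'a matroid_data \<Rightarrow> 'a set \<Rightarrow> 'a set set" where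
  "live_strata M B =
     {\<sigma>. stratum (ground M - B) \<sigma> \<and> U_set (fund_circuit M B) \<sigma> \<notin> indeps M}"

definition K_matroid :: "'a matroid_data \<Rightarrow> 'a set \<Rightarrow> 'a set \<Rightarrow> 'a matroid_data" where
  "K_matroid M B \<sigma> = contraction
     (restriction M (A_set (fund_circuit M B) \<sigma>)) (U_set (fund_circuit M B) \<sigma>)"

text \<open>\<open>a\<close> passes at \<open>\<tau>\<close>, for a choice \<open>F\<close> of sets at the dead strata: \<open>\<tau>\<close> is dead and
  \<open>a|\<^sub>\<tau> - b\<^sub>\<tau> \<in> F(\<tau>)\<close>.  This is only used when \<open>\<tau>\<close> can be fired from \<open>a\<close>, so that
  the subtraction of natural numbers is never truncated.\<close>

definition passes ::
    "'a matroid_data \<Rightarrow> 'a set \<Rightarrow> ('a set \<rightharpoonup> ('a \<Rightarrow> nat) set) \<Rightarrow> 'a set \<Rightarrow> ('a \<Rightarrow> nat) \<Rightarrow> bool" where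
  "passes M B F \<tau> a \<longleftrightarrow> \<tau> \<in> dead_strata M B \<and>
     (\<lambda>i. restr \<tau> a i - baseline (fund_circuit M B) \<tau> i) \<in> the (F \<tau>)"

text \<open>\<open>fibre_at M B F \<sigma> X\<close>: \<open>X\<close> is a fibre at \<open>\<sigma>\<close>, given the values of \<open>F\<close> at the dead strata
  properly contained in \<open>\<sigma>\<close> (no other values of \<open>F\<close> matter).\<close>

definition fibre_at ::
    "'a matroid_data \<Rightarrow> 'a set \<Rightarrow> ('a set \<rightharpoonup> ('a \<Rightarrow> nat) set) \<Rightarrow> 'a set \<Rightarrow> ('a \<Rightarrow> nat) set \<Rightarrow> bool"
  where
  "fibre_at M B F \<sigma> X \<longleftrightarrow>
     pure_multicomplex \<sigma> X \<and> has_degree_sequence \<sigma> X (h_vector (K_matroid M B \<sigma>)) \<and>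
     (\<forall>m \<in> X. \<forall>\<tau>. stratum (ground M - B) \<tau> \<and> \<tau> \<subset> \<sigma> \<and>
        can_fire (fund_circuit M B) \<tau> (\<lambda>i. baseline (fund_circuit M B) \<sigma> i + m i) \<longrightarrow>
        passes M B F \<tau> (\<lambda>i. baseline (fund_circuit M B) \<sigma> i + m i))"

text \<open>A fibre system is a map with domain the set of dead strata, so that it carries no data
  beyond its fibres, and equality of maps is equality of fibre systems.\<close>

definition fibre_system ::
    "'a matroid_data \<Rightarrow> 'a set \<Rightarrow> ('a set \<rightharpoonup> ('a \<Rightarrow> nat) set) \<Rightarrow> bool" where
  "fibre_system M B F \<longleftrightarrow> dom F = dead_strata M B \<and>
     (\<forall>\<sigma> \<in> dead_strata M B. fibre_at M B F \<sigma> (the (F \<sigma>)))"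

definition coparking_fibre ::
    "'a matroid_data \<Rightarrow> 'a set \<Rightarrow> ('a set \<rightharpoonup> ('a \<Rightarrow> nat) set) \<Rightarrow> ('a \<Rightarrow> nat) set" where
  "coparking_fibre M B F = {a \<in> vectors (ground M - B).
     \<forall>\<tau>. stratum (ground M - B) \<tau> \<and> can_fire (fund_circuit M B) \<tau> a \<longrightarrow> passes M B F \<tau> a}"

end

theory Submission
  imports Defs
begin

text \<open>
  In a generalized cycle system, \<open>U\<^sub>\<sigma>\<close> spans \<open>A\<^sub>\<sigma>\<close> for every dead stratum \<open>\<sigma>\<close>.  Hence \<open>K\<^sub>\<sigma>\<close> has rank
  \<open>0\<close> and \<open>h\<close>-vector \<open>(1)\<close>, so that \<open>{0}\<close> is the only possible fibre at \<open>\<sigma>\<close>; it is a fibre because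
  baselines decrease when strata grow (\<open>fibre_at_zero_fibres\<close>).  For these fibres, \<open>\<P>\<^sup>*(F)\<close> consists of
  the \<open>a\<close> such that every stratum that can be fired from \<open>a\<close> is dead and fired exactly at its
  baseline: the \<^emph>\<open>tight coparking functions\<close>.  If there are no dead strata, these are the coparking
  functions.  It remains to prove that they form a pure multicomplex with degree sequence \<open>h(M)\<close>.

  The fireable sets of \<open>a\<close> have a largest member \<open>S0\<close>, and the indices outside \<open>S0\<close> can be burnt one
  by one, as in Dhar's algorithm for parking functions.  Each burnt index releases an element which
  is not a coloop of what is left, so burning bounds the nullity of what remains
  (\<open>burning_nullity\<close>).  Purity follows: raising \<open>a\<close> at each burnt index as far as the burning order
  permits produces a tight coparking function above \<open>a\<close> whose degree is the number of covered elements
  minus the number of circuits, whatever \<open>a\<close> was (\<open>extend_to_full_degree\<close>).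

  The degree sequence comes from deletion and contraction.  Let \<open>e\<close> be an element that lies in exactly
  one set \<open>C\<^sub>i\<close> of the family.  The tight coparking functions with \<open>a\<^sub>i = 0\<close> are those of the family
  without \<open>C\<^sub>i\<close> in \<open>M\<close> with \<open>e\<close> deleted (\<open>tight_coparking_delete\<close>); those with \<open>a\<^sub>i > 0\<close> become, after
  lowering \<open>a\<^sub>i\<close> by one, those of the family \<open>C\<^sub>j - {e}\<close> in \<open>M\<close> with \<open>e\<close> contracted
  (\<open>tight_coparking_contract_iff\<close>).  This matches
  \<open>h\<^sub>k(M) = h\<^sub>k(M - e) + h\<^sub>k\<^sub>-\<^sub>1(M / e)\<close>; if \<open>e\<close> is a loop, there are none with \<open>a\<^sub>i > 0\<close>, and
  \<open>h(M) = h(M - e)\<close>.  The second correspondence requires that no relevant dead stratum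
  becomes live under contraction, which again follows from the burning bound
  (\<open>private_element_not_spanned\<close>).  As contraction does not preserve fundamental circuits, the induction
  runs over a larger class of families (\<open>spanning_family\<close>) that is closed under deletion and contraction of
  such elements \<open>e\<close>.
\<close>

section \<open>Sets covered exactly once by a family\<close>

lemma mem_U_set_iff: "e \<in> U_set C S \<longleftrightarrow> (\<exists>!i. i \<in> S \<and> e \<in> C i)"
proof -
  have "card {i \<in> S. e \<in> C i} = 1 \<longleftrightarrow> (\<exists>j. \<forall>i. i \<in> S \<and> e \<in> C i \<longleftrightarrow> i = j)"
    by (simp add: card_1_singleton_iff set_eq_iff)
  also have "\<dots> \<longleftrightarrow> (\<exists>!i. i \<in> S \<and> e \<in> C i)"
    by metis
  finally have "card {i \<in> S. e \<in> C i} = 1 \<longleftrightarrow> (\<exists>!i. i \<in> S \<and> e \<in> C i)" .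
  then show ?thesis
    by (simp add: U_set_def multiplicity_in_def)
qed

lemma U_set_subset_A_set: "U_set C S \<subseteq> A_set C S"
  by (auto simp: mem_U_set_iff A_set_def)

text \<open>The baseline of \<open>j\<close> decreases as the stratum grows.  Hence unions of fireable sets are fireable,
  and an index that lies below its baseline in \<open>T\<close> belongs to no fireable subset of \<open>T\<close>.\<close>

lemma U_set_private_antimono: "j \<in> S \<Longrightarrow> S \<subseteq> T \<Longrightarrow> C j \<inter> U_set C T \<subseteq> C j \<inter> U_set C S"
  unfolding mem_U_set_iff subset_iff Int_iff by blast

text \<open>Summed along a sequence of removals of indices, this disjoint decomposition turns baselines of
  single indices into cardinalities of covered sets.\<close>

lemma A_set_peel:
  assumes "j \<in> S"
  shows "A_set C S = A_set C (S - {j}) \<union> (C j \<inter> U_set C S)"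
    and "A_set C (S - {j}) \<inter> (C j \<inter> U_set C S) = {}"
proof -
  show "A_set C S = A_set C (S - {j}) \<union> (C j \<inter> U_set C S)"
  proof (intro equalityI subsetI)
    fix x assume "x \<in> A_set C S"
    then obtain i where i: "i \<in> S" "x \<in> C i" by (auto simp: A_set_def)
    show "x \<in> A_set C (S - {j}) \<union> (C j \<inter> U_set C S)"
    proof (cases "x \<in> A_set C (S - {j})")
      case False
      then have "k = j" if "k \<in> S" "x \<in> C k" for k
        using that by (auto simp: A_set_def)
      then show ?thesis using i by (auto simp: mem_U_set_iff)
    qed simp
  qed (use assms in \<open>auto simp: A_set_def\<close>)
  show "A_set C (S - {j}) \<inter> (C j \<inter> U_set C S) = {}"
    using assms by (auto simp: A_set_def mem_U_set_iff)
qed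

lemma U_set_Diff: "U_set (\<lambda>j. C j - {e}) S = U_set C S - {e}"
  by (auto simp: mem_U_set_iff)

lemma A_set_Diff: "A_set (\<lambda>j. C j - {e}) S = A_set C S - {e}"
  by (auto simp: A_set_def)

lemma sum_card_private:
  assumes "finite S" and "finite (A_set C S)"
  shows "(\<Sum>j\<in>S. card (C j \<inter> U_set C S)) = card (U_set C S)"
proof -
  have fin: "finite (U_set C S)"
    using assms(2) U_set_subset_A_set finite_subset by metis
  have "card (\<Union>j\<in>S. C j \<inter> U_set C S) = (\<Sum>j\<in>S. card (C j \<inter> U_set C S))"
    using assms(1) fin by (intro card_UN_disjoint) (auto simp: mem_U_set_iff)
  moreover have "(\<Union>j\<in>S. C j \<inter> U_set C S) = U_set C S"
    by (auto simp: mem_U_set_iff)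
  ultimately show ?thesis by simp
qed

lemma can_fire_iff: "can_fire C S a \<longleftrightarrow> (\<forall>i\<in>S. card (C i \<inter> U_set C S) \<le> a i)"
  by (simp add: can_fire_def baseline_def restr_def)

lemma restr_eq_baseline_iff: "restr S a = baseline C S \<longleftrightarrow> (\<forall>i\<in>S. a i = card (C i \<inter> U_set C S))"
  by (auto simp: baseline_def restr_def fun_eq_iff)


section \<open>Rank functions\<close>

definition nullity :: "('a set \<Rightarrow> nat) \<Rightarrow> 'a set \<Rightarrow> nat" where
  "nullity r X = card X - r X"

text \<open>Deletion and contraction are carried out on rank functions.  Then deletion only shrinks \<open>E\<close>, and
  contraction has a closed formula that needs no new matroid.\<close>

locale rank_function =
  fixes E :: "'a set" and r :: "'a set \<Rightarrow> nat"
  assumes finite_E: "finite E"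
    and rank_le_card: "X \<subseteq> E \<Longrightarrow> r X \<le> card X"
    and rank_mono: "X \<subseteq> Y \<Longrightarrow> Y \<subseteq> E \<Longrightarrow> r X \<le> r Y"
    and rank_submod: "X \<subseteq> E \<Longrightarrow> Y \<subseteq> E \<Longrightarrow> r (X \<union> Y) + r (X \<inter> Y) \<le> r X + r Y"
begin

lemma rank_empty: "r {} = 0"
  using rank_le_card[of "{}"] by simp

lemma finite_sub: "X \<subseteq> E \<Longrightarrow> finite X"
  using finite_E finite_subset by blast

lemma rank_plus_nullity: "X \<subseteq> E \<Longrightarrow> r X + nullity r X = card X"
  using rank_le_card[of X] by (simp add: nullity_def)

lemma nullity_mono:
  assumes "X \<subseteq> Y" and "Y \<subseteq> E"
  shows "nullity r X \<le> nullity r Y"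
proof -
  have "r (X \<union> (Y - X)) + r (X \<inter> (Y - X)) \<le> r X + r (Y - X)"
    using assms by (intro rank_submod) auto
  moreover have "r (Y - X) \<le> card (Y - X)"
    using assms by (intro rank_le_card) auto
  moreover have "card Y = card X + card (Y - X)"
    using assms finite_sub[of Y] by (metis card_mono card_Diff_subset finite_subset le_add_diff_inverse)
  moreover have "X \<union> (Y - X) = Y" using assms(1) by auto
  ultimately show ?thesis
    using rank_plus_nullity[of X] rank_plus_nullity[of Y] assms rank_empty
    by (simp add: order_trans[OF assms])
qed

lemma independent_subset:
  assumes "X \<subseteq> Y" and "Y \<subseteq> E" and "r Y = card Y"
  shows "r X = card X"
  using nullity_mono[OF assms(1,2)] rank_plus_nullity[of X] rank_plus_nullity[of Y] assms
  by (simp add: order_trans[OF assms(1,2)])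

lemma rank_Diff_non_coloop:
  assumes "f \<in> D" and "D \<subseteq> X" and "X \<subseteq> E" and "r (D - {f}) = r D"
  shows "r (X - {f}) = r X"
proof -
  have "r (D \<union> (X - {f})) + r (D \<inter> (X - {f})) \<le> r D + r (X - {f})"
    using assms by (intro rank_submod) auto
  moreover have "D \<union> (X - {f}) = X" "D \<inter> (X - {f}) = D - {f}"
    using assms by auto
  moreover have "r (X - {f}) \<le> r X"
    using assms by (intro rank_mono) auto
  ultimately show ?thesis using assms(4) by simp
qed

lemma rank_insert_spanning:
  assumes "X \<subseteq> Y" and "Y \<subseteq> E" and "e \<in> E" and "r X = r Y"
  shows "r (insert e X) = r (insert e Y)"
proof (rule antisym)
  show "r (insert e X) \<le> r (insert e Y)"
    using assms by (intro rank_mono) auto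
  have "r (Y \<union> insert e X) + r (Y \<inter> insert e X) \<le> r Y + r (insert e X)"
    using assms by (intro rank_submod) auto
  moreover have "Y \<union> insert e X = insert e Y" using assms(1) by blast
  moreover have "r X \<le> r (Y \<inter> insert e X)"
    using assms by (intro rank_mono) auto
  ultimately show "r (insert e Y) \<le> r (insert e X)"
    using assms(4) by simp
qed

lemma rank_function_restrict: "E' \<subseteq> E \<Longrightarrow> rank_function E' r"
proof
  show "finite E'" if "E' \<subseteq> E" using finite_sub[OF that] .
qed (meson order_trans rank_le_card rank_mono rank_submod)+

end

text \<open>Used only for \<open>r {e} = 1\<close>, where the subtraction is not truncated.\<close>

definition contract_rank :: "('a set \<Rightarrow> nat) \<Rightarrow> 'a \<Rightarrow> 'a set \<Rightarrow> nat" where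
  "contract_rank r e X = r (insert e X) - 1"

lemma (in rank_function) rank_insert_pos:
  assumes "e \<in> E" and "r {e} = 1" and "X \<subseteq> E"
  shows "r (insert e X) \<ge> 1"
  using rank_mono[of "{e}" "insert e X"] assms by simp

lemma (in rank_function) Suc_contract_rank:
  assumes "e \<in> E" and "r {e} = 1" and "X \<subseteq> E"
  shows "Suc (contract_rank r e X) = r (insert e X)"
  using rank_insert_pos[OF assms] by (simp add: contract_rank_def)

lemma (in rank_function) rank_function_contract:
  assumes "e \<in> E" and "r {e} = 1"
  shows "rank_function (E - {e}) (contract_rank r e)"
proof
  show "finite (E - {e})" using finite_E by simp
  fix X assume X: "X \<subseteq> E - {e}"
  have "r (insert e X) \<le> card (insert e X)"
    using X assms by (intro rank_le_card) auto
  moreover have "card (insert e X) \<le> Suc (card X)"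
    by (cases "finite X") (simp_all add: card_insert_if)
  ultimately show "contract_rank r e X \<le> card X"
    unfolding contract_rank_def by linarith
next
  fix X Y assume "X \<subseteq> Y" "Y \<subseteq> E - {e}"
  then have "r (insert e X) \<le> r (insert e Y)"
    using assms by (intro rank_mono) auto
  then show "contract_rank r e X \<le> contract_rank r e Y"
    by (simp add: contract_rank_def)
next
  fix X Y assume XY: "X \<subseteq> E - {e}" "Y \<subseteq> E - {e}"
  have "r (insert e X \<union> insert e Y) + r (insert e X \<inter> insert e Y) \<le> r (insert e X) + r (insert e Y)"
    using XY assms by (intro rank_submod) auto
  moreover have "insert e X \<union> insert e Y = insert e (X \<union> Y)" "insert e X \<inter> insert e Y = insert e (X \<inter> Y)"
    by auto
  moreover have "X \<subseteq> E" "Y \<subseteq> E" "X \<union> Y \<subseteq> E" "X \<inter> Y \<subseteq> E" using XY by auto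
  ultimately show "contract_rank r e (X \<union> Y) + contract_rank r e (X \<inter> Y)
      \<le> contract_rank r e X + contract_rank r e Y"
    using Suc_contract_rank[OF assms, of X] Suc_contract_rank[OF assms, of Y]
      Suc_contract_rank[OF assms, of "X \<union> Y"] Suc_contract_rank[OF assms, of "X \<inter> Y"]
    by simp
qed

section \<open>The h-vector in terms of the rank function\<close>

text \<open>This is \<open>T(x,1)\<close>: at \<open>y = 1\<close> only the sets of nullity \<open>0\<close> survive in the corank-nullity
  expansion of the Tutte polynomial.\<close>

definition indep_poly :: "'a set \<Rightarrow> ('a set \<Rightarrow> nat) \<Rightarrow> int poly" where
  "indep_poly E r = (\<Sum>A | A \<subseteq> E \<and> r A = card A. [:-1, 1:] ^ (r E - card A))"

definition h_coeff :: "'a set \<Rightarrow> ('a set \<Rightarrow> nat) \<Rightarrow> nat \<Rightarrow> int" where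
  "h_coeff E r k = (if k \<le> r E then coeff (indep_poly E r) (r E - k) else 0)"

lemma h_vector_eq_h_coeff:
  assumes "finite (ground M)" and "\<And>A. A \<subseteq> ground M \<Longrightarrow> rank M A \<le> card A"
  shows "h_vector M = h_coeff (ground M) (rank M)"
proof -
  let ?r = "rank M" and ?E = "ground M"
  have zero: "poly ([:-1, 1:] ^ n :: int poly poly) 1 = (if n = 0 then 1 else 0)" for n
    by (simp add: poly_power)
  have "poly (tutte M) 1 = (\<Sum>A\<in>Pow ?E. [:-1, 1:] ^ (?r ?E - ?r A) * (if card A - ?r A = 0 then 1 else 0))"
    unfolding tutte_def poly_sum poly_mult zero by (simp add: poly_power)
  also have "\<dots> = (\<Sum>A\<in>Pow ?E. if ?r A = card A then [:-1, 1:] ^ (?r ?E - card A) else 0)"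
    using assms(2) by (intro sum.cong) (auto dest: le_antisym)
  also have "\<dots> = (\<Sum>A\<in>{A \<in> Pow ?E. ?r A = card A}. [:-1, 1:] ^ (?r ?E - card A))"
    using assms(1) by (intro sum.inter_filter[symmetric]) simp
  also have "\<dots> = indep_poly ?E ?r"
    by (simp add: indep_poly_def)
  finally show ?thesis
    by (simp add: fun_eq_iff h_vector_def h_coeff_def)
qed

lemma degree_indep_poly: "finite E \<Longrightarrow> degree (indep_poly E r) \<le> r E"
  unfolding indep_poly_def
  by (rule degree_sum_le) (auto intro: order_trans[OF degree_power_le])

text \<open>The independent sets that avoid \<open>e\<close> are those of the deletion, and the independent sets that
  contain \<open>e\<close> are those of the contraction with \<open>e\<close> added.  As \<open>e\<close> is no coloop, the deletion has
  full rank, so the exponents agree.\<close>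

lemma (in rank_function) indep_poly_deletion_contraction:
  assumes e: "e \<in> E" "r {e} = 1" and nc: "r (E - {e}) = r E"
  shows "indep_poly E r = indep_poly (E - {e}) r + indep_poly (E - {e}) (contract_rank r e)"
proof -
  let ?f = "\<lambda>A. [:-1, 1:] ^ (r E - card A) :: int poly"
  let ?N = "{A. A \<subseteq> E - {e} \<and> r A = card A}"
  let ?D = "{A. A \<subseteq> E - {e} \<and> contract_rank r e A = card A}"
  have card_ins: "card (insert e A) = Suc (card A)" if "A \<subseteq> E - {e}" for A
  proof -
    have "finite A" "e \<notin> A" using that finite_sub[of A] by blast+
    then show ?thesis by simp
  qed
  have split: "{A. A \<subseteq> E \<and> r A = card A} = ?N \<union> insert e ` ?D"
  proof (intro equalityI subsetI)
    fix A assume A: "A \<in> {A. A \<subseteq> E \<and> r A = card A}"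
    show "A \<in> ?N \<union> insert e ` ?D"
    proof (cases "e \<in> A")
      case True
      then have eq: "A = insert e (A - {e})" and sub: "A - {e} \<subseteq> E - {e}"
        using A by auto
      have "Suc (contract_rank r e (A - {e})) = r A"
        using Suc_contract_rank[OF e, of "A - {e}"] A eq by auto
      also have "\<dots> = Suc (card (A - {e}))"
        using A card_ins[OF sub] eq by simp
      finally show ?thesis using eq sub by blast
    qed (use A in auto)
  next
    fix A assume "A \<in> ?N \<union> insert e ` ?D"
    then show "A \<in> {A. A \<subseteq> E \<and> r A = card A}"
    proof
      assume "A \<in> insert e ` ?D"
      then obtain A' where A': "A = insert e A'" "A' \<subseteq> E - {e}" "contract_rank r e A' = card A'"
        by auto
      moreover have "A' \<subseteq> E" using A'(2) by blast
      ultimately have "r A = card A"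
        using Suc_contract_rank[OF e, of A'] card_ins[OF A'(2)] by simp
      then show ?thesis using A' e by auto
    qed auto
  qed
  have "indep_poly E r = sum ?f ?N + sum ?f (insert e ` ?D)"
    unfolding indep_poly_def split using finite_E
    by (intro sum.union_disjoint) auto
  moreover have "sum ?f ?N = indep_poly (E - {e}) r"
    by (simp add: indep_poly_def nc)
  moreover have "sum ?f (insert e ` ?D) = indep_poly (E - {e}) (contract_rank r e)"
  proof -
    have "inj_on (insert e) ?D" by (auto simp: inj_on_def)
    then have "sum ?f (insert e ` ?D) = (\<Sum>A\<in>?D. ?f (insert e A))"
      by (simp add: sum.reindex)
    also have "\<dots> = indep_poly (E - {e}) (contract_rank r e)"
      unfolding indep_poly_def
    proof (intro sum.cong refl)
      fix A assume "A \<in> ?D"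
      then have "r E - card (insert e A) = contract_rank r e (E - {e}) - card A"
        using card_ins[of A] e by (simp add: contract_rank_def insert_absorb)
      then show "?f (insert e A) = [:-1, 1:] ^ (contract_rank r e (E - {e}) - card A)"
        by simp
    qed
    finally show ?thesis .
  qed
  ultimately show ?thesis by simp
qed

lemma (in rank_function) h_coeff_deletion_contraction:
  assumes e: "e \<in> E" "r {e} = 1" and nc: "r (E - {e}) = r E"
  shows "h_coeff E r k = h_coeff (E - {e}) r k
    + (if k = 0 then 0 else h_coeff (E - {e}) (contract_rank r e) (k - 1))"
proof -
  let ?c = "contract_rank r e"
  have Suc: "Suc (?c (E - {e})) = r E"
    using Suc_contract_rank[OF e, of "E - {e}"] e by (simp add: insert_absorb)
  show ?thesis
  proof (cases k)
    case 0
    \<comment> \<open>The contraction has smaller rank, so it does not reach the leading coefficient.\<close>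
    have "coeff (indep_poly (E - {e}) ?c) (r E) = 0"
      using degree_indep_poly[of "E - {e}" ?c] finite_E Suc by (intro coeff_eq_0) simp
    then show ?thesis
      by (simp add: h_coeff_def 0 nc indep_poly_deletion_contraction[OF assms])
  next
    case (Suc k')
    then show ?thesis
      using \<open>Suc (?c (E - {e})) = r E\<close>[symmetric] nc
      by (simp add: h_coeff_def indep_poly_deletion_contraction[OF assms])
  qed
qed

lemma (in rank_function) h_coeff_delete_loop:
  assumes e: "e \<in> E" "r {e} = 0"
  shows "h_coeff E r = h_coeff (E - {e}) r"
proof -
  have "r E + r {} \<le> r (E - {e}) + r {e}"
    using rank_submod[of "E - {e}" "{e}"] e by (simp add: insert_absorb Int_commute)
  then have nc: "r (E - {e}) = r E"
    using rank_mono[of "E - {e}" E] e by (simp add: le_antisym Diff_subset)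
  have "{A. A \<subseteq> E \<and> r A = card A} = {A. A \<subseteq> E - {e} \<and> r A = card A}"
    using independent_subset[of "{e}"] e by force
  then have "indep_poly E r = indep_poly (E - {e}) r"
    by (simp add: indep_poly_def nc)
  then show ?thesis by (simp add: fun_eq_iff h_coeff_def nc)
qed

lemma sum_Pow_power:
  assumes "finite B"
  shows "(\<Sum>A\<in>Pow B. (x :: 'b :: comm_ring_1) ^ (card B - card A)) = (x + 1) ^ card B"
proof -
  have "(x + 1) ^ card B = (\<Prod>b\<in>B. 1 + x)"
    by (simp add: add.commute)
  also have "\<dots> = (\<Sum>A\<in>Pow B. x ^ card (B - A))"
    unfolding prod_add[OF assms] by simp
  also have "\<dots> = (\<Sum>A\<in>Pow B. x ^ (card B - card A))"
    using assms by (intro sum.cong) (auto simp: card_Diff_subset finite_subset)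
  finally show ?thesis by simp
qed

text \<open>If all of \<open>L\<close> are loops and all other elements are coloops, the independent sets are the subsets
  of \<open>E - L\<close>, and by the binomial theorem \<open>T(x,1) = ((x - 1) + 1) ^ card (E - L)\<close>.\<close>

lemma (in rank_function) h_coeff_loops_and_coloops:
  assumes "L \<subseteq> E" and "r L = 0" and "r E = card (E - L)"
  shows "h_coeff E r k = (if k = 0 then 1 else 0)"
proof -
  let ?B = "E - L"
  have indB: "r ?B = card ?B"
    using rank_submod[of ?B L] rank_le_card[of ?B] assms
    by (simp add: Un_absorb2 Un_absorb1 Int_commute)
  have "A \<subseteq> ?B" if "A \<subseteq> E" "r A = card A" for A
  proof
    fix x assume x: "x \<in> A"
    have "r {x} = 1"
      using independent_subset[of "{x}" A] that x by auto
    then have "x \<notin> L"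
      using rank_mono[of "{x}" L] assms by auto
    then show "x \<in> ?B" using x that by auto
  qed
  moreover have "r A = card A" if "A \<subseteq> ?B" for A
    using independent_subset[OF that] indB by auto
  ultimately have "{A. A \<subseteq> E \<and> r A = card A} = Pow ?B" by blast
  then have "indep_poly E r = [:0, 1:] ^ card ?B"
    using sum_Pow_power[of ?B "[:-1, 1:] :: int poly"] finite_E assms(3)
    by (simp add: indep_poly_def one_pCons)
  also have "\<dots> = monom 1 (card ?B)"
    by (simp add: monom_altdef)
  finally show ?thesis using assms(3) by (simp add: h_coeff_def) linarith
qed


section \<open>Burning\<close>

text \<open>The empty set can always be fired; so the largest fireable set exists for every \<open>a\<close> and is empty
  precisely when no stratum can be fired.\<close>

definition largest_fireable :: "'i set \<Rightarrow> ('i \<Rightarrow> 'a set) \<Rightarrow> ('i \<Rightarrow> nat) \<Rightarrow> 'i set \<Rightarrow> bool" where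
  "largest_fireable I C a S0 \<longleftrightarrow> S0 \<subseteq> I \<and> can_fire C S0 a \<and>
     (\<forall>T. T \<subseteq> I \<longrightarrow> can_fire C T a \<longrightarrow> T \<subseteq> S0)"

lemma obtain_largest_fireable:
  assumes "\<And>i. i \<in> I \<Longrightarrow> finite (C i)"
  obtains S0 where "largest_fireable I C a S0"
proof -
  define S0 where "S0 = \<Union>{S. S \<subseteq> I \<and> can_fire C S a}"
  have "can_fire C S0 a"
    unfolding can_fire_iff
  proof
    fix i assume "i \<in> S0"
    then obtain S where S: "i \<in> S" "S \<subseteq> I" "can_fire C S a"
      unfolding S0_def by blast
    have "S \<subseteq> S0" using S unfolding S0_def by blast
    have "card (C i \<inter> U_set C S0) \<le> card (C i \<inter> U_set C S)"
      using assms[of i] S \<open>S \<subseteq> S0\<close> by (intro card_mono U_set_private_antimono) auto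
    then show "card (C i \<inter> U_set C S0) \<le> a i"
      using S by (auto simp: can_fire_iff)
  qed
  then show thesis
    by (intro that[of S0]) (auto simp: largest_fireable_def S0_def)
qed

text \<open>Dhar's burning algorithm as an induction rule.  As long as \<open>S\<close> is larger than the largest fireable
  set \<open>S0\<close>, it cannot be fired, so some \<open>j \<in> S\<close> lies below its baseline; this \<open>j\<close> burns and is
  removed.  It never belongs to \<open>S0\<close>, because its baseline in \<open>S0\<close> is at least that in \<open>S\<close>.\<close>

lemma burning_induct:
  assumes "finite I" and "\<And>i. i \<in> I \<Longrightarrow> finite (C i)"
    and S0: "largest_fireable I C a S0"
    and base: "P S0"
    and step: "\<And>S j. \<lbrakk>S0 \<subseteq> S; S \<subseteq> I; j \<in> S - S0; a j < card (C j \<inter> U_set C S); P (S - {j})\<rbrakk> \<Longrightarrow> P S"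
  shows "P I"
proof -
  have "P S" if "S0 \<subseteq> S" "S \<subseteq> I" for S
    using that
  proof (induction "card (S - S0)" arbitrary: S rule: less_induct)
    case less
    show ?case
    proof (cases "S = S0")
      case False
      then have "\<not> can_fire C S a" using less.prems S0 by (auto simp: largest_fireable_def)
      then obtain j where j: "j \<in> S" "a j < card (C j \<inter> U_set C S)"
        by (auto simp: can_fire_iff not_le)
      have "j \<notin> S0"
      proof
        assume "j \<in> S0"
        then have "card (C j \<inter> U_set C S) \<le> card (C j \<inter> U_set C S0)"
          using less.prems assms(2)[of j] by (intro card_mono U_set_private_antimono) auto
        then show False using j S0 \<open>j \<in> S0\<close> by (fastforce simp: can_fire_iff largest_fireable_def)
      qed
      moreover have "card (S - {j} - S0) < card (S - S0)"
        using j \<open>j \<notin> S0\<close> finite_subset[OF less.prems(2) assms(1)] by (intro psubset_card_mono) auto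
      ultimately show ?thesis
        using less j by (intro step[of S j]) auto
    qed (simp add: base)
  qed
  then show ?thesis using S0 by (simp add: largest_fireable_def)
qed


section \<open>Spanning families\<close>

text \<open>The class of families on which deletion and contraction act.  It contains the fundamental circuits
  whenever they form a generalized cycle system, but contraction destroys the private elements of the circuits and the
  property of being circuits; what survives is that each \<open>C i\<close> is a cycle of the matroid
  (\<open>no_coloop\<close>), that \<open>S\<close> accounts for at least \<open>card S\<close> units of nullity, and that an independent
  \<open>U_set C S\<close> spans.  The nullity bound has to be demanded separately: without it, two equal loops
  \<open>C 1 = C 2 = {x}\<close> and \<open>C 3 = {e, f, h}\<close> with \<open>e\<close> a loop and \<open>f\<close>, \<open>h\<close> parallel would satisfy the other
  conditions and violate \<open>degree_sequence_tight_coparking\<close>.\<close>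

locale spanning_family = rank_function E r
  for E :: "'a set" and r :: "'a set \<Rightarrow> nat" +
  fixes I :: "'i set" and C :: "'i \<Rightarrow> 'a set"
  assumes finite_I: "finite I"
    and C_subset: "i \<in> I \<Longrightarrow> C i \<subseteq> E"
    and card_I: "r E + card I = card E"
    and no_coloop: "i \<in> I \<Longrightarrow> f \<in> C i \<Longrightarrow> r (C i - {f}) = r (C i)"
    and nullity_A_set: "S \<subseteq> I \<Longrightarrow> card S \<le> nullity r (A_set C S)"
    and spanning: "S \<subseteq> I \<Longrightarrow> S \<noteq> {} \<Longrightarrow> r (U_set C S) = card (U_set C S) \<Longrightarrow>
      r (A_set C S) = r (U_set C S)"

text \<open>For the family of fundamental circuits this is \<open>\<P>\<^sup>*(F)\<close> for the fibre system with all fibres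
  \<open>{0}\<close>; being dead is expressed by the rank function.\<close>

definition tight_coparking :: "('a set \<Rightarrow> nat) \<Rightarrow> 'i set \<Rightarrow> ('i \<Rightarrow> 'a set) \<Rightarrow> ('i \<Rightarrow> nat) set" where
  "tight_coparking r I C = {a \<in> vectors I. \<forall>S. stratum I S \<and> can_fire C S a \<longrightarrow>
     r (U_set C S) = card (U_set C S) \<and> restr S a = baseline C S}"

lemma mem_tight_coparking:
  "a \<in> tight_coparking r I C \<longleftrightarrow> a \<in> vectors I \<and> (\<forall>S. S \<subseteq> I \<longrightarrow> S \<noteq> {} \<longrightarrow> can_fire C S a \<longrightarrow>
     r (U_set C S) = card (U_set C S) \<and> (\<forall>i\<in>S. a i = card (C i \<inter> U_set C S)))"
  unfolding tight_coparking_def stratum_def restr_eq_baseline_iff by blast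

context spanning_family
begin

lemma A_set_subset: "S \<subseteq> I \<Longrightarrow> A_set C S \<subseteq> E"
  using C_subset by (auto simp: A_set_def)

lemma U_set_subset: "S \<subseteq> I \<Longrightarrow> U_set C S \<subseteq> E"
  by (rule order_trans[OF U_set_subset_A_set A_set_subset])

lemma finite_C: "i \<in> I \<Longrightarrow> finite (C i)"
  by (rule finite_sub[OF C_subset])

text \<open>Every burnt \<open>j\<close> frees an element \<open>f\<close> that only \<open>C j\<close> covers among the sets still present.  Since
  \<open>C j\<close> is a cycle, \<open>f\<close> is no coloop, and deleting it lowers the nullity by one.  Starting from a total
  nullity of \<open>card I\<close>, at most \<open>card S0\<close> units remain when the fire stops.  The elements of \<open>Z\<close> are kept
  throughout: if \<open>a j\<close> is at least the size of \<open>C j \<inter> Z\<close>, then the baseline that \<open>a j\<close> fails to reach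
  leaves room for an \<open>f\<close> outside \<open>Z\<close>.\<close>

lemma burning_nullity:
  assumes S0: "largest_fireable I C a S0"
    and Z: "Z \<subseteq> E" "\<And>j. j \<in> I - S0 \<Longrightarrow> card (C j \<inter> Z) \<le> a j"
  shows "nullity r (A_set C S0 \<union> Z) \<le> card S0"
proof -
  have "nullity r (A_set C S0 \<union> Z) + card (I - S0) \<le> nullity r (A_set C I \<union> Z)"
  proof (rule burning_induct[OF finite_I finite_C S0])
    fix S j
    assume burn: "S0 \<subseteq> S" "S \<subseteq> I" "j \<in> S - S0" "a j < card (C j \<inter> U_set C S)"
      and IH: "nullity r (A_set C S0 \<union> Z) + card (S - {j} - S0) \<le> nullity r (A_set C (S - {j}) \<union> Z)"
    then have j: "j \<in> S" "j \<in> I" "j \<in> I - S0" by auto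
    have "card (C j \<inter> Z) < card (C j \<inter> U_set C S)"
      using burn(4) Z(2)[of j] j by simp
    moreover have "finite (C j \<inter> Z)" using finite_C[of j] j by blast
    ultimately have "\<not> C j \<inter> U_set C S \<subseteq> C j \<inter> Z"
      using card_mono[of "C j \<inter> Z" "C j \<inter> U_set C S"] by (meson not_le)
    then obtain f where f: "f \<in> C j" "f \<in> U_set C S" "f \<notin> Z" by blast
    let ?X = "A_set C S \<union> Z"
    have X: "?X \<subseteq> E" using A_set_subset[of S] burn Z by auto
    have sub: "C j \<subseteq> ?X" using j by (auto simp: A_set_def)
    have rf: "r (?X - {f}) = r ?X"
      using rank_Diff_non_coloop[OF f(1) sub X] no_coloop[of j f] j f by simp
    have "Suc (nullity r (?X - {f})) = nullity r ?X"
    proof -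
      have "Suc (card (?X - {f})) = card ?X"
        using f sub finite_sub[OF X] by (intro card.remove[symmetric]) auto
      moreover have "?X - {f} \<subseteq> E" using X by blast
      ultimately show ?thesis
        using rank_plus_nullity[of ?X] rank_plus_nullity[of "?X - {f}"] X rf by linarith
    qed
    moreover have "A_set C (S - {j}) \<union> Z \<subseteq> ?X - {f}"
      using f A_set_peel[of j S C] j by auto
    then have "nullity r (A_set C (S - {j}) \<union> Z) \<le> nullity r (?X - {f})"
      using X by (intro nullity_mono) auto
    moreover have "card (S - S0) = Suc (card (S - {j} - S0))"
    proof -
      have "finite (S - S0)" using burn finite_I finite_subset by blast
      then have "card (S - S0) = Suc (card (S - S0 - {j}))"
        using burn by (intro card.remove) auto
      moreover have "S - S0 - {j} = S - {j} - S0" by auto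
      ultimately show ?thesis by simp
    qed
    ultimately show "nullity r (A_set C S0 \<union> Z) + card (S - S0) \<le> nullity r (A_set C S \<union> Z)"
      using IH by simp
  qed simp_all
  also have "\<dots> \<le> nullity r E"
    using A_set_subset[of I] Z by (intro nullity_mono) auto
  also have "\<dots> = card I"
    using card_I rank_plus_nullity[of E] by simp
  also have "\<dots> = card S0 + card (I - S0)"
    using S0 finite_I unfolding largest_fireable_def by (metis card_Diff_subset card_mono finite_subset le_add_diff_inverse)
  finally show ?thesis by simp
qed

text \<open>The point at which deletion and contraction could fail: a dead stratum \<open>S\<close> that does not contain \<open>i\<close>
  becomes live in the contraction by \<open>e\<close> if \<open>e\<close> is spanned by \<open>A_set C S\<close>.  Suppose that this happens
  while \<open>S\<close> can be fired and \<open>a i > 0\<close>, and let \<open>S0 \<supseteq> S\<close> be the largest fireable set.  If \<open>i \<in> S0\<close>,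
  then tightness at \<open>S\<close> and \<open>S0\<close> forces \<open>U_set C S \<subseteq> U_set C S0\<close>, and the independent set
  \<open>U_set C S0\<close> contains both \<open>e\<close> and a set spanning \<open>e\<close>.  If \<open>i\<close> burns, then \<open>e\<close> can be kept during
  the burning because \<open>a i > 0\<close>; adding the spanned element \<open>e\<close> to \<open>A_set C S0\<close> gives nullity at least
  \<open>card S0 + 1\<close>, more than burning leaves.  The case \<open>S = {}\<close> is included and deals with loops \<open>e\<close>.\<close>

lemma private_element_not_spanned:
  assumes a: "a \<in> tight_coparking r I C" and S: "S \<subseteq> I" "can_fire C S a"
    and i: "i \<in> I" "i \<notin> S" and e: "e \<in> C i" "e \<in> U_set C I" and pos: "a i > 0"
  shows "r (insert e (A_set C S)) = Suc (r (A_set C S))"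
proof (rule ccontr)
  assume asm: "r (insert e (A_set C S)) \<noteq> Suc (r (A_set C S))"
  have only: "j = i" if "j \<in> I" "e \<in> C j" for j
    using that e i by (auto simp: mem_U_set_iff)
  have eE: "e \<in> E" using e i C_subset by auto
  have eA: "e \<notin> A_set C S" using only S i by (auto simp: A_set_def)
  have AS: "A_set C S \<subseteq> E" using A_set_subset S by auto
  have "r (insert e (A_set C S)) \<le> r (A_set C S) + 1"
    using nullity_mono[of "A_set C S" "insert e (A_set C S)"] rank_plus_nullity[of "A_set C S"]
      rank_plus_nullity[of "insert e (A_set C S)"] AS eE finite_sub[OF AS] eA
    by (simp add: subset_insertI)
  moreover have "r (A_set C S) \<le> r (insert e (A_set C S))"
    using AS eE by (intro rank_mono) auto
  ultimately have spanned: "r (insert e (A_set C S)) = r (A_set C S)"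
    using asm by linarith
  obtain S0 where largest: "largest_fireable I C a S0"
    using obtain_largest_fireable[of I C a] finite_C by metis
  then have S0: "S0 \<subseteq> I" "can_fire C S0 a"
    "\<And>T. T \<subseteq> I \<Longrightarrow> can_fire C T a \<Longrightarrow> T \<subseteq> S0"
    by (auto simp: largest_fireable_def)
  have SS0: "S \<subseteq> S0" using S0(3) S by blast
  show False
  proof (cases "i \<in> S0")
    case True
    then have tight: "r (U_set C S0) = card (U_set C S0)" "\<forall>j\<in>S0. a j = card (C j \<inter> U_set C S0)"
      using a S0 unfolding mem_tight_coparking by blast+
    have "U_set C S \<subseteq> U_set C S0 \<and> r (U_set C S) = card (U_set C S) \<and> r (A_set C S) = r (U_set C S)"
    proof (cases "S = {}")
      case True
      then show ?thesis by (simp add: mem_U_set_iff A_set_def rank_empty U_set_def multiplicity_in_def)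
    next
      case False
      then have tS: "r (U_set C S) = card (U_set C S)" "\<forall>j\<in>S. a j = card (C j \<inter> U_set C S)"
        using a S unfolding mem_tight_coparking by blast+
      have "U_set C S \<subseteq> U_set C S0"
      proof
        fix x assume x: "x \<in> U_set C S"
        then obtain j where j: "j \<in> S" "x \<in> C j" by (auto simp: mem_U_set_iff)
        have "j \<in> S0" "finite (C j)" using j SS0 S finite_C by auto
        then have "card (C j \<inter> U_set C S0) = card (C j \<inter> U_set C S)"
          using j tS(2) tight(2) by metis
        then have "C j \<inter> U_set C S0 = C j \<inter> U_set C S"
          using j SS0 \<open>finite (C j)\<close> by (intro card_subset_eq U_set_private_antimono) auto
        then show "x \<in> U_set C S0" using x j by blast
      qed
      then show ?thesis using tS spanning[OF S(1) False] by simp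
    qed
    then have US: "U_set C S \<subseteq> U_set C S0" "r (U_set C S) = card (U_set C S)"
      "r (A_set C S) = r (U_set C S)" by auto
    have "e \<in> U_set C S0"
      using U_set_private_antimono[OF True S0(1), of C] e by blast
    then have "r (insert e (U_set C S)) = card (insert e (U_set C S))"
      using US(1) by (intro independent_subset[OF _ U_set_subset[OF S0(1)] tight(1)]) simp
    moreover have "e \<notin> U_set C S" "finite (U_set C S)"
      using eA U_set_subset_A_set[of C S] finite_sub[OF U_set_subset[OF S(1)]] by blast+
    moreover have "r (insert e (U_set C S)) \<le> r (insert e (A_set C S))"
      using U_set_subset_A_set[of C S] AS eE by (intro rank_mono) auto
    ultimately show False using spanned US by simp
  next
    case False
    have eA0: "e \<notin> A_set C S0" using only S0 False by (auto simp: A_set_def)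
    have A0: "A_set C S0 \<subseteq> E" using A_set_subset S0 by auto
    have "nullity r (A_set C S0 \<union> {e}) \<le> card S0"
    proof (rule burning_nullity[OF largest])
      fix j assume j: "j \<in> I - S0"
      show "card (C j \<inter> {e}) \<le> a j"
        using only[of j] j pos by (cases "e \<in> C j") auto
    qed (use eE in auto)
    then have "nullity r (insert e (A_set C S0)) \<le> nullity r (A_set C S0)"
      using nullity_A_set[OF S0(1)] by simp
    moreover have "r (insert e (A_set C S0) - {e}) = r (insert e (A_set C S0))"
    proof (rule rank_Diff_non_coloop[of e "insert e (A_set C S)"])
      show "insert e (A_set C S) \<subseteq> insert e (A_set C S0)"
        using SS0 by (auto simp: A_set_def)
    qed (use spanned eA A0 eE in auto)
    ultimately show False
      using rank_plus_nullity[OF A0] rank_plus_nullity[of "insert e (A_set C S0)"] A0 eE eA0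
        finite_sub[OF A0] by simp
  qed
qed

end


section \<open>Purity\<close>

context spanning_family
begin

lemma zero_mem_tight_coparking: "(\<lambda>_. 0) \<in> tight_coparking r I C"
  unfolding mem_tight_coparking
proof (intro conjI allI impI)
  show "(\<lambda>_. 0) \<in> vectors I" by (simp add: vectors_def)
  fix S assume S: "S \<subseteq> I" "S \<noteq> {}" and fire: "can_fire C S (\<lambda>_. 0)"
  have "C i \<inter> U_set C S = {}" if "i \<in> S" for i
  proof -
    have "card (C i \<inter> U_set C S) = 0" using fire that by (simp add: can_fire_iff)
    moreover have "finite (C i \<inter> U_set C S)" using that S finite_C by blast
    ultimately show ?thesis by simp
  qed
  moreover from this have "U_set C S = {}"
    using U_set_subset_A_set[of C S] by (fastforce simp: A_set_def)
  ultimately show "r (U_set C S) = card (U_set C S)" "\<forall>i\<in>S. 0 = card (C i \<inter> U_set C S)"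
    by (auto simp: rank_empty)
qed

lemma tight_coparking_down_closed:
  assumes a: "a \<in> tight_coparking r I C" and le: "b \<le> a"
  shows "b \<in> tight_coparking r I C"
  unfolding mem_tight_coparking
proof (intro conjI allI impI)
  show "b \<in> vectors I"
    using a le unfolding mem_tight_coparking vectors_def le_fun_def mem_Collect_eq by (metis le_zero_eq)
  fix S assume S: "S \<subseteq> I" "S \<noteq> {}" and fire: "can_fire C S b"
  have "can_fire C S a"
    using fire le by (auto simp: can_fire_iff le_fun_def intro: order_trans)
  then have tight: "r (U_set C S) = card (U_set C S)" "\<forall>i\<in>S. a i = card (C i \<inter> U_set C S)"
    using a S unfolding mem_tight_coparking by blast+
  then show "r (U_set C S) = card (U_set C S)" by simp
  show "\<forall>i\<in>S. b i = card (C i \<inter> U_set C S)"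
    using tight(2) fire le unfolding can_fire_iff le_fun_def by (metis antisym)
qed

lemma finite_tight_coparking: "finite (tight_coparking r I C)"
proof (rule finite_subset)
  have le: "a i \<le> card E" if a: "a \<in> tight_coparking r I C" and i: "i \<in> I" for a i
  proof -
    have "a i \<le> card (C i \<inter> U_set C {i})"
    proof (rule ccontr)
      assume neg: "\<not> ?thesis"
      then have "can_fire C {i} a" by (simp add: can_fire_iff)
      then show False using a i neg unfolding mem_tight_coparking by (auto dest!: spec[of _ "{i}"])
    qed
    also have "\<dots> \<le> card E"
      using C_subset[OF i] finite_E by (intro card_mono) auto
    finally show ?thesis .
  qed
  show "tight_coparking r I C \<subseteq> {a. \<forall>i. (i \<in> I \<longrightarrow> a i \<in> {..card E}) \<and> (i \<notin> I \<longrightarrow> a i = 0)}"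
    using le by (auto simp: tight_coparking_def vectors_def)
  show "finite {a. \<forall>i. (i \<in> I \<longrightarrow> a i \<in> {..card E}) \<and> (i \<notin> I \<longrightarrow> a i = 0)}"
    using finite_I by (intro finite_set_of_finite_funs) auto
qed

text \<open>Raise every burnt \<open>a j\<close> to one less than the baseline at the moment when \<open>j\<close> burns.  The same
  burning order stays valid, so no new set becomes fireable and the result is still tight.  Its degree
  is a telescoping sum: the burnt indices contribute the cardinality of \<open>A_set C I - A_set C S0\<close> minus
  one each, and \<open>S0\<close> contributes \<open>card (U_set C S0) = r (A_set C S0)\<close>, which is the cardinality of
  \<open>A_set C S0\<close> minus \<open>card S0\<close> because the nullity of \<open>A_set C S0\<close> is exactly \<open>card S0\<close>.\<close>

lemma extend_to_full_degree:
  assumes a: "a \<in> tight_coparking r I C"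
  obtains a' where "a' \<in> tight_coparking r I C" "a \<le> a'" "vdegree I a' + card I = card (A_set C I)"
proof -
  obtain S0 where largest: "largest_fireable I C a S0"
    using obtain_largest_fireable[of I C a] finite_C by metis
  then have S0: "S0 \<subseteq> I" "can_fire C S0 a"
    "\<And>T. T \<subseteq> I \<Longrightarrow> can_fire C T a \<Longrightarrow> T \<subseteq> S0"
    by (auto simp: largest_fireable_def)
  have finS0: "finite S0" using S0(1) finite_I finite_subset by blast
  let ?P = "\<lambda>S. \<exists>a'. a \<le> a' \<and> (\<forall>j. j \<notin> S - S0 \<longrightarrow> a' j = a j) \<and>
      (\<forall>T. T \<subseteq> S \<longrightarrow> can_fire C T a' \<longrightarrow> T \<subseteq> S0) \<and>
      sum a' (S - S0) + card (S - S0) + card (A_set C S0) = card (A_set C S)"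
  have "?P I"
  proof (rule burning_induct[OF finite_I finite_C largest])
    show "?P S0" by (intro exI[of _ a]) auto
  next
    fix S j
    assume burn: "S0 \<subseteq> S" "S \<subseteq> I" "j \<in> S - S0" "a j < card (C j \<inter> U_set C S)"
      and IH: "?P (S - {j})"
    obtain b where b: "a \<le> b" "\<And>k. k \<notin> S - {j} - S0 \<Longrightarrow> b k = a k"
      "\<And>T. T \<subseteq> S - {j} \<Longrightarrow> can_fire C T b \<Longrightarrow> T \<subseteq> S0"
      "sum b (S - {j} - S0) + card (S - {j} - S0) + card (A_set C S0) = card (A_set C (S - {j}))"
      using IH by blast
    let ?m = "card (C j \<inter> U_set C S)"
    let ?b = "b(j := ?m - 1)"
    have "a \<le> ?b"
      using b(1) burn(4) by (auto simp: le_fun_def)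
    moreover have "\<forall>k. k \<notin> S - S0 \<longrightarrow> ?b k = a k"
      using b(2) burn(3) by auto
    moreover have "T \<subseteq> S0" if T: "T \<subseteq> S" "can_fire C T ?b" for T
    proof (cases "j \<in> T")
      case True
      have "?m \<le> card (C j \<inter> U_set C T)"
        using True T burn finite_C[of j] by (intro card_mono U_set_private_antimono) auto
      moreover have "card (C j \<inter> U_set C T) \<le> ?m - 1"
        using T True by (auto simp: can_fire_iff)
      ultimately show ?thesis using burn(4) by linarith
    next
      case False
      then have "can_fire C T b"
        using T(2) unfolding can_fire_iff by (metis fun_upd_other)
      then show ?thesis using b(3) T False by blast
    qed
    moreover have "sum ?b (S - S0) + card (S - S0) + card (A_set C S0) = card (A_set C S)"
    proof -
      have fin: "finite (S - S0)" using burn finite_I finite_subset by blast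
      have eq: "S - S0 - {j} = S - {j} - S0" by auto
      have "sum ?b (S - S0) = ?m - 1 + sum ?b (S - S0 - {j})"
        using fin burn(3) by (simp add: sum.remove)
      also have "sum ?b (S - S0 - {j}) = sum b (S - {j} - S0)"
        unfolding eq by (intro sum.cong) auto
      finally have 1: "sum ?b (S - S0) = ?m - 1 + sum b (S - {j} - S0)" .
      have 2: "card (S - S0) = Suc (card (S - {j} - S0))"
        using card.remove[OF fin burn(3)] eq by simp
      have j: "j \<in> S" using burn by simp
      have "finite (A_set C S)" using A_set_subset[OF burn(2)] finite_sub by blast
      then have "card (A_set C S) = card (A_set C (S - {j})) + ?m"
        using A_set_peel[OF j, of C] card_Un_disjoint[of "A_set C (S - {j})" "C j \<inter> U_set C S"]
        by simp
      then show ?thesis using 1 2 b(4) burn(4) by linarith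
    qed
    ultimately show "?P S" by blast
  qed simp_all
  then obtain a' where a': "a \<le> a'" "\<And>j. j \<notin> I - S0 \<Longrightarrow> a' j = a j"
      "\<And>T. T \<subseteq> I \<Longrightarrow> can_fire C T a' \<Longrightarrow> T \<subseteq> S0"
      "sum a' (I - S0) + card (I - S0) + card (A_set C S0) = card (A_set C I)"
    by blast
  have mem: "a' \<in> tight_coparking r I C"
    unfolding mem_tight_coparking
  proof (intro conjI allI impI)
    show "a' \<in> vectors I"
      using a a'(2) unfolding mem_tight_coparking vectors_def by simp
    fix S assume S: "S \<subseteq> I" "S \<noteq> {}" and fire: "can_fire C S a'"
    have eq: "a' j = a j" if "j \<in> S" for j
      using a'(2)[of j] a'(3)[OF S(1) fire] that by blast
    then have "can_fire C S a" using fire by (simp add: can_fire_iff)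
    then show "r (U_set C S) = card (U_set C S)" "\<forall>i\<in>S. a' i = card (C i \<inter> U_set C S)"
      using a S eq unfolding mem_tight_coparking by auto
  qed
  have "sum a' S0 + card S0 = card (A_set C S0)"
  proof (cases "S0 = {}")
    case False
    then have tight: "r (U_set C S0) = card (U_set C S0)" "\<forall>j\<in>S0. a j = card (C j \<inter> U_set C S0)"
      using a S0 unfolding mem_tight_coparking by blast+
    have "nullity r (A_set C S0) \<le> card S0"
      using burning_nullity[OF largest, of "{}"] by simp
    then have null: "nullity r (A_set C S0) = card S0"
      using nullity_A_set[OF S0(1)] by simp
    have "sum a' S0 = (\<Sum>j\<in>S0. card (C j \<inter> U_set C S0))"
      using tight(2) a'(2) by (intro sum.cong) auto
    also have "\<dots> = card (U_set C S0)"
      using finS0 finite_sub[OF A_set_subset[OF S0(1)]] by (rule sum_card_private)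
    also have "\<dots> = r (A_set C S0)"
      using spanning[OF S0(1) False tight(1)] tight(1) by simp
    finally show ?thesis
      using rank_plus_nullity[OF A_set_subset[OF S0(1)]] null by simp
  qed (simp add: A_set_def)
  moreover have "vdegree I a' = sum a' (I - S0) + sum a' S0"
    unfolding vdegree_def using S0(1) finite_I by (rule sum.subset_diff)
  moreover have "card I = card (I - S0) + card S0"
    using S0(1) finite_I finS0 by (simp add: card_Diff_subset card_mono)
  ultimately have "vdegree I a' + card I = card (A_set C I)"
    using a'(4) by linarith
  then show thesis using that mem a'(1) by blast
qed

theorem pure_tight_coparking: "pure_multicomplex I (tight_coparking r I C)"
proof -
  have "vdegree I a + card I = card (A_set C I)" if "maximal_in (tight_coparking r I C) a" for a
    using extend_to_full_degree[of a] that unfolding maximal_in_def by metis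
  then have "vdegree I a = vdegree I b" if "maximal_in (tight_coparking r I C) a"
      "maximal_in (tight_coparking r I C) b" for a b
    using that by (metis add_right_cancel)
  moreover have "tight_coparking r I C \<subseteq> vectors I"
    unfolding tight_coparking_def by blast
  moreover have "\<forall>a\<in>tight_coparking r I C. \<forall>b. b \<le> a \<longrightarrow> b \<in> tight_coparking r I C"
    by (intro ballI allI impI) (rule tight_coparking_down_closed)
  ultimately show ?thesis
    using finite_tight_coparking unfolding pure_multicomplex_def multicomplex_def
    by (intro conjI allI impI) assumption+
qed

end

section \<open>Deletion and contraction\<close>

text \<open>An element of \<open>U_set C I\<close> is covered by a single \<open>C i\<close>, hence uniquely covered in every stratum
  containing \<open>i\<close>; it is the element at which the recursion branches.\<close>

lemma (in spanning_family) private_elementD: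
  assumes "i \<in> I" "e \<in> C i" "e \<in> U_set C I"
  shows "e \<in> E" and "\<And>j. j \<in> I \<Longrightarrow> e \<in> C j \<longleftrightarrow> j = i"
    and "\<And>S. S \<subseteq> I \<Longrightarrow> e \<in> A_set C S \<longleftrightarrow> i \<in> S" and "\<And>S. S \<subseteq> I \<Longrightarrow> e \<in> U_set C S \<longleftrightarrow> i \<in> S"
    and "r (E - {e}) = r E"
proof -
  show "e \<in> E" using assms C_subset by blast
  show only: "e \<in> C j \<longleftrightarrow> j = i" if "j \<in> I" for j
    using assms that by (auto simp: mem_U_set_iff)
  show "e \<in> A_set C S \<longleftrightarrow> i \<in> S" if "S \<subseteq> I" for S
    using only that assms by (auto simp: A_set_def)
  show "e \<in> U_set C S \<longleftrightarrow> i \<in> S" if "S \<subseteq> I" for S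
  proof
    show "i \<in> S" if "e \<in> U_set C S"
      using that only \<open>S \<subseteq> I\<close> unfolding mem_U_set_iff by blast
    show "e \<in> U_set C S" if "i \<in> S"
      using U_set_private_antimono[OF that \<open>S \<subseteq> I\<close>, of C] assms by blast
  qed
  show "r (E - {e}) = r E"
    by (rule rank_Diff_non_coloop[OF assms(2) C_subset[OF assms(1)] subset_refl no_coloop[OF assms(1,2)]])
qed

lemma (in spanning_family) spanning_family_delete:
  assumes "i \<in> I" "e \<in> C i" "e \<in> U_set C I"
  shows "spanning_family (E - {e}) r (I - {i}) C"
proof -
  note priv = private_elementD[OF assms]
  interpret del: rank_function "E - {e}" r by (rule rank_function_restrict) auto
  show ?thesis
  proof
    show "finite (I - {i})" using finite_I by simp
    show "C j \<subseteq> E - {e}" if "j \<in> I - {i}" for j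
      using that priv(2)[of j] C_subset[of j] by auto
    show "r (E - {e}) + card (I - {i}) = card (E - {e})"
      using priv(5) card_I card.remove[OF finite_I assms(1)] card.remove[OF finite_E priv(1)] by linarith
    show "r (C j - {f}) = r (C j)" if "j \<in> I - {i}" "f \<in> C j" for j f
      using that no_coloop by simp
    show "card S \<le> nullity r (A_set C S)" if "S \<subseteq> I - {i}" for S
      using that by (intro nullity_A_set) auto
    show "r (A_set C S) = r (U_set C S)"
      if "S \<subseteq> I - {i}" "S \<noteq> {}" "r (U_set C S) = card (U_set C S)" for S
      using that by (intro spanning) auto
  qed
qed

lemma (in rank_function) contract_independent_iff:
  assumes "e \<in> E" "r {e} = 1" "X \<subseteq> E"
  shows "contract_rank r e (X - {e}) = card (X - {e}) \<longleftrightarrow> r (insert e X) = card (insert e X)"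
proof -
  have "X - {e} \<subseteq> E" using assms(3) by blast
  moreover have "card (insert e X) = Suc (card (X - {e}))"
    using finite_sub[OF assms(3)] by (rule card.insert_remove)
  ultimately show ?thesis
    using Suc_contract_rank[OF assms(1,2), of "X - {e}"] by auto
qed

lemma (in spanning_family) spanning_family_contract:
  assumes "i \<in> I" "e \<in> C i" "e \<in> U_set C I" and r: "r {e} = 1"
  shows "spanning_family (E - {e}) (contract_rank r e) I (\<lambda>j. C j - {e})"
proof -
  note priv = private_elementD[OF assms(1-3)]
  interpret con: rank_function "E - {e}" "contract_rank r e"
    using priv(1) r by (rule rank_function_contract)
  have Suc: "Suc (contract_rank r e (X - {e})) = r (insert e X)" if "X \<subseteq> E" for X
    using Suc_contract_rank[OF priv(1) r, of "X - {e}"] that by auto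
  show ?thesis
  proof
    show "finite I" by (rule finite_I)
    show "C j - {e} \<subseteq> E - {e}" if "j \<in> I" for j
      using C_subset[OF that] by auto
    show "contract_rank r e (E - {e}) + card I = card (E - {e})"
      using Suc[OF subset_refl] card_I card.remove[OF finite_E priv(1)] insert_absorb[OF priv(1)]
      by (metis add_Suc nat.inject)
    show "contract_rank r e (C j - {e} - {f}) = contract_rank r e (C j - {e})"
      if j: "j \<in> I" and f: "f \<in> C j - {e}" for j f
    proof -
      have "r (insert e (C j) - {f}) = r (insert e (C j))"
      proof (rule rank_Diff_non_coloop)
        show "f \<in> C j" using f by blast
        then show "r (C j - {f}) = r (C j)" by (rule no_coloop[OF j])
      qed (use C_subset[OF j] priv(1) in blast)+
      moreover have "insert e (C j) - {f} = insert e (C j - {f})" using f by auto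
      moreover have "C j - {e} - {f} = C j - {f} - {e}" by auto
      moreover have "C j - {f} \<subseteq> E" using C_subset[OF j] by blast
      ultimately show ?thesis
        using Suc[of "C j - {f}"] Suc[OF C_subset[OF j]] by simp
    qed
    show "card S \<le> nullity (contract_rank r e) (A_set (\<lambda>j. C j - {e}) S)" if S: "S \<subseteq> I" for S
    proof -
      note AS = A_set_subset[OF S]
      have "card S \<le> nullity r (A_set C S)" by (rule nullity_A_set[OF S])
      also have "\<dots> \<le> nullity r (insert e (A_set C S))"
        using AS priv(1) by (intro nullity_mono) auto
      also have "\<dots> = nullity (contract_rank r e) (A_set C S - {e})"
        using Suc[OF AS] card.insert_remove[OF finite_sub[OF AS], of e] unfolding nullity_def by linarith
      finally show ?thesis by (simp add: A_set_Diff)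
    qed
    show "contract_rank r e (A_set (\<lambda>j. C j - {e}) S) = contract_rank r e (U_set (\<lambda>j. C j - {e}) S)"
      if S: "S \<subseteq> I" "S \<noteq> {}" and
        ind: "contract_rank r e (U_set (\<lambda>j. C j - {e}) S) = card (U_set (\<lambda>j. C j - {e}) S)" for S
    proof -
      note AS = A_set_subset[OF S(1)] and US = U_set_subset[OF S(1)]
      have "r (insert e (U_set C S)) = card (insert e (U_set C S))"
        using ind contract_independent_iff[OF priv(1) r US] by (simp add: U_set_Diff)
      then have "r (U_set C S) = card (U_set C S)"
        by (rule independent_subset[of _ "insert e (U_set C S)", rotated 2]) (use US priv(1) in auto)
      then have "r (insert e (U_set C S)) = r (insert e (A_set C S))"
        using spanning[OF S] by (intro rank_insert_spanning[OF U_set_subset_A_set AS priv(1)]) simp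
      then show ?thesis using Suc[OF AS] Suc[OF US] by (simp add: U_set_Diff A_set_Diff)
    qed
  qed
qed

text \<open>If \<open>a i = 0\<close>, then no stratum containing \<open>i\<close> can be fired, because \<open>e\<close> makes the baseline of \<open>i\<close>
  positive; the other strata do not see \<open>i\<close> or \<open>e\<close>.\<close>

lemma (in spanning_family) tight_coparking_delete:
  assumes "i \<in> I" "e \<in> C i" "e \<in> U_set C I"
  shows "{a \<in> tight_coparking r I C. a i = 0} = tight_coparking r (I - {i}) C"
proof (intro equalityI subsetI)
  fix a assume "a \<in> {a \<in> tight_coparking r I C. a i = 0}"
  then have a: "a \<in> tight_coparking r I C" "a i = 0" by auto
  show "a \<in> tight_coparking r (I - {i}) C"
    unfolding mem_tight_coparking
  proof (intro conjI allI impI)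
    show "a \<in> vectors (I - {i})"
      using a unfolding mem_tight_coparking vectors_def by auto
    fix S assume "S \<subseteq> I - {i}" "S \<noteq> {}" "can_fire C S a"
    moreover from this have "S \<subseteq> I" by blast
    ultimately show "r (U_set C S) = card (U_set C S)" "\<forall>j\<in>S. a j = card (C j \<inter> U_set C S)"
      using a(1) unfolding mem_tight_coparking by simp_all
  qed
next
  fix a assume a: "a \<in> tight_coparking r (I - {i}) C"
  then have 0: "a i = 0" and vec: "a \<in> vectors I"
    unfolding mem_tight_coparking vectors_def by auto
  have "i \<notin> S" if S: "S \<subseteq> I" "can_fire C S a" for S
  proof
    assume i: "i \<in> S"
    then have "e \<in> C i \<inter> U_set C S"
      using private_elementD(4)[OF assms S(1)] assms by simp
    then have "0 < card (C i \<inter> U_set C S)"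
      using finite_C[OF assms(1)] by (auto simp: card_gt_0_iff)
    then show False using S(2) i 0 by (auto simp: can_fire_iff)
  qed
  then have "S \<subseteq> I - {i}" if "S \<subseteq> I" "can_fire C S a" for S
    using that by blast
  then have "a \<in> tight_coparking r I C"
    using a vec unfolding mem_tight_coparking by simp
  then show "a \<in> {a \<in> tight_coparking r I C. a i = 0}" using 0 by simp
qed

text \<open>Contracting \<open>e\<close> lowers the baseline of \<open>i\<close> by one in every stratum containing \<open>i\<close> and changes no
  other baseline, so firing and tightness correspond.  A stratum that is dead in the contraction is dead
  in the original family; the converse, for the strata that can be fired, is
  \<open>private_element_not_spanned\<close>.\<close>

lemma (in spanning_family) tight_coparking_contract_iff:
  assumes "i \<in> I" "e \<in> C i" "e \<in> U_set C I" and r: "r {e} = 1"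
  shows "b \<in> tight_coparking (contract_rank r e) I (\<lambda>j. C j - {e}) \<longleftrightarrow>
    b(i := Suc (b i)) \<in> tight_coparking r I C"
    (is "b \<in> ?P' \<longleftrightarrow> ?a \<in> ?P")
proof -
  note priv = private_elementD[OF assms(1-3)]
  let ?C' = "\<lambda>j. C j - {e}"
  have card_eq: "card (C j \<inter> U_set C S) = card (?C' j \<inter> U_set ?C' S) + (if j = i then 1 else 0)"
    if "S \<subseteq> I" "j \<in> S" for S j
  proof -
    have "?C' j \<inter> U_set ?C' S = C j \<inter> U_set C S - {e}" by (auto simp: U_set_Diff)
    moreover have "e \<in> C j \<inter> U_set C S \<longleftrightarrow> j = i"
      using priv(2)[of j] priv(4)[of S] that by auto
    moreover have "finite (C j \<inter> U_set C S)" using that finite_C by blast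
    ultimately show ?thesis
      using card.remove[of "C j \<inter> U_set C S" e] by (cases "j = i") (auto simp del: card_Diff_singleton)
  qed
  have fire_iff: "can_fire ?C' S b \<longleftrightarrow> can_fire C S ?a" if "S \<subseteq> I" for S
    unfolding can_fire_iff using card_eq[OF that] by (intro ball_cong) auto
  have eq_iff: "(\<forall>j\<in>S. b j = card (?C' j \<inter> U_set ?C' S)) \<longleftrightarrow> (\<forall>j\<in>S. ?a j = card (C j \<inter> U_set C S))"
    if "S \<subseteq> I" for S
    using card_eq[OF that] by (intro ball_cong) auto
  have ind_iff: "contract_rank r e (U_set ?C' S) = card (U_set ?C' S) \<longleftrightarrow>
      r (insert e (U_set C S)) = card (insert e (U_set C S))" if "S \<subseteq> I" for S
    using contract_independent_iff[OF priv(1) r U_set_subset[OF that]] by (simp add: U_set_Diff)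
  have vec: "b \<in> vectors I \<longleftrightarrow> ?a \<in> vectors I"
    using assms(1) by (auto simp: vectors_def)
  show ?thesis
  proof
    assume b: "b \<in> ?P'"
    show "?a \<in> ?P"
      unfolding mem_tight_coparking
    proof (intro conjI allI impI)
      show "?a \<in> vectors I" using b vec by (simp add: mem_tight_coparking)
      fix S assume S: "S \<subseteq> I" "S \<noteq> {}" "can_fire C S ?a"
      then have tight: "contract_rank r e (U_set ?C' S) = card (U_set ?C' S)"
          "\<forall>j\<in>S. b j = card (?C' j \<inter> U_set ?C' S)"
        using b fire_iff[OF S(1)] unfolding mem_tight_coparking by blast+
      show "\<forall>j\<in>S. ?a j = card (C j \<inter> U_set C S)"
        using tight(2) eq_iff[OF S(1)] by blast
      show "r (U_set C S) = card (U_set C S)"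
        by (rule independent_subset[of _ "insert e (U_set C S)"])
          (use tight(1) ind_iff[OF S(1)] U_set_subset[OF S(1)] priv(1) in auto)
    qed
  next
    assume a: "?a \<in> ?P"
    show "b \<in> ?P'"
      unfolding mem_tight_coparking
    proof (intro conjI allI impI)
      show "b \<in> vectors I" using a vec by (simp add: mem_tight_coparking)
      fix S assume S: "S \<subseteq> I" "S \<noteq> {}" and fire': "can_fire ?C' S b"
      then have fire: "can_fire C S ?a" using fire_iff by blast
      then have tight: "r (U_set C S) = card (U_set C S)" "\<forall>j\<in>S. ?a j = card (C j \<inter> U_set C S)"
        using a S unfolding mem_tight_coparking by blast+
      show "\<forall>j\<in>S. b j = card (?C' j \<inter> U_set ?C' S)"
        using tight(2) eq_iff[OF S(1)] by blast
      have "r (insert e (U_set C S)) = card (insert e (U_set C S))"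
      proof (cases "i \<in> S")
        case True
        then show ?thesis using tight(1) priv(4)[OF S(1)] by (simp add: insert_absorb)
      next
        case False
        note rA = spanning[OF S tight(1)]
        have "r (insert e (A_set C S)) = Suc (r (A_set C S))"
          using private_element_not_spanned[OF a S(1) fire assms(1) False assms(2,3)] by simp
        moreover have "r (insert e (U_set C S)) = r (insert e (A_set C S))"
          using U_set_subset_A_set A_set_subset[OF S(1)] priv(1) rA[symmetric] by (rule rank_insert_spanning)
        ultimately show ?thesis
          using tight(1) rA priv(4)[OF S(1)] False finite_sub[OF U_set_subset[OF S(1)]] by simp
      qed
      then show "contract_rank r e (U_set ?C' S) = card (U_set ?C' S)"
        using ind_iff[OF S(1)] by blast
    qed
  qed
qed

lemma (in spanning_family) tight_coparking_private_loop:
  assumes "i \<in> I" "e \<in> C i" "e \<in> U_set C I" and r: "r {e} \<noteq> 1" and a: "a \<in> tight_coparking r I C"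
  shows "a i = 0"
proof (rule ccontr)
  assume "a i \<noteq> 0"
  then have "r (insert e (A_set C {})) = Suc (r (A_set C {}))"
    by (intro private_element_not_spanned[OF a _ _ assms(1) _ assms(2,3)]) (simp_all add: can_fire_iff)
  then show False using r by (simp add: A_set_def rank_empty)
qed

text \<open>Tight coparking functions satisfy the deletion-contraction recursion of the \<open>h\<close>-vector at any element
  \<open>e\<close> of \<open>U_set C I\<close>.  The recursion ends when \<open>U_set C I\<close> is empty.  Then \<open>I\<close> is either empty or a dead
  stratum with baseline \<open>0\<close> that is always fired, so only \<open>a = 0\<close> is tight; moreover the covered elements
  are loops, and by the nullity bound all other elements are coloops.\<close>

theorem degree_sequence_tight_coparking:
  assumes "spanning_family E r I C"
  shows "has_degree_sequence I (tight_coparking r I C) (h_coeff E r)"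
  using assms
proof (induction "card E" arbitrary: E r I C rule: less_induct)
  case less
  interpret spanning_family E r I C by fact
  let ?P = "tight_coparking r I C"
  show ?case
  proof (cases "U_set C I = {}")
    case True
    have loops: "r (A_set C I) = 0"
    proof (cases "I = {}")
      case False
      then show ?thesis using spanning[OF subset_refl] True by (simp add: rank_empty)
    qed (simp add: A_set_def rank_empty)
    have "a = (\<lambda>_. 0)" if a: "a \<in> ?P" for a
    proof
      fix i
      have "can_fire C I a" using True by (simp add: can_fire_iff)
      then have "\<forall>j\<in>I. a j = 0"
        using a True unfolding mem_tight_coparking by (cases "I = {}") auto
      then show "a i = 0"
        using a unfolding mem_tight_coparking vectors_def by (cases "i \<in> I") auto
    qed
    then have P: "?P = {\<lambda>_. 0}" using zero_mem_tight_coparking by blast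
    note A = A_set_subset[OF subset_refl]
    have "r E \<le> card (E - A_set C I)"
      using rank_submod[OF A, of "E - A_set C I"] loops rank_le_card[of "E - A_set C I"] A
      by (simp add: Un_absorb1)
    moreover have "card (E - A_set C I) = card E - card (A_set C I)" "card (A_set C I) \<le> card E"
      using A finite_E finite_sub[OF A] by (auto simp: card_Diff_subset card_mono)
    moreover have "card I \<le> card (A_set C I)"
      using nullity_A_set[OF subset_refl] by (simp add: nullity_def loops)
    ultimately have "r E = card (E - A_set C I)" using card_I by linarith
    then show ?thesis
      unfolding has_degree_sequence_def P
      using h_coeff_loops_and_coloops[OF A loops] by (simp add: vdegree_def Collect_conv_if)
  next
    case False
    then obtain e where e: "e \<in> U_set C I" by blast
    then obtain i where "i \<in> I" "e \<in> C i" unfolding mem_U_set_iff by blast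
    note ei = this e
    note priv = private_elementD[OF ei]
    have smaller: "card (E - {e}) < card E"
      using priv(1) finite_E by (intro psubset_card_mono) auto
    have IH_delete: "has_degree_sequence (I - {i}) (tight_coparking r (I - {i}) C) (h_coeff (E - {e}) r)"
      by (rule less.hyps[OF smaller spanning_family_delete[OF ei]])
    have deleted: "int (card {a \<in> ?P. a i = 0 \<and> vdegree I a = k}) = h_coeff (E - {e}) r k" for k
    proof -
      have "{a \<in> ?P. a i = 0 \<and> vdegree I a = k}
          = {a \<in> tight_coparking r (I - {i}) C. vdegree (I - {i}) a = k}"
        unfolding tight_coparking_delete[OF ei, symmetric] vdegree_def
        using ei(1) finite_I by (auto simp: sum.remove)
      then show ?thesis using IH_delete by (simp add: has_degree_sequence_def)
    qed
    have split: "card {a \<in> ?P. vdegree I a = k} =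
        card {a \<in> ?P. a i = 0 \<and> vdegree I a = k} + card {a \<in> ?P. a i > 0 \<and> vdegree I a = k}" for k
    proof -
      have "{a \<in> ?P. vdegree I a = k} =
          {a \<in> ?P. a i = 0 \<and> vdegree I a = k} \<union> {a \<in> ?P. a i > 0 \<and> vdegree I a = k}" by auto
      then show ?thesis
        using finite_tight_coparking by (auto intro!: card_Un_disjoint)
    qed
    show ?thesis
    proof (cases "r {e} = 1")
      case True
      let ?P' = "tight_coparking (contract_rank r e) I (\<lambda>j. C j - {e})"
      let ?inc = "\<lambda>b :: 'b \<Rightarrow> nat. b(i := Suc (b i))"
      have IH_contract: "has_degree_sequence I ?P' (h_coeff (E - {e}) (contract_rank r e))"
        by (rule less.hyps[OF smaller spanning_family_contract[OF ei True]])
      have deg: "vdegree I (?inc b) = Suc (vdegree I b)" for b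
        unfolding vdegree_def using ei(1) finite_I by (simp add: sum.remove)
      have "{a \<in> ?P. a i > 0 \<and> vdegree I a = k} = ?inc ` {b \<in> ?P'. Suc (vdegree I b) = k}" for k
      proof (intro equalityI subsetI)
        fix a assume a: "a \<in> {a \<in> ?P. a i > 0 \<and> vdegree I a = k}"
        then have eq: "a = ?inc (a(i := a i - 1))" by auto
        show "a \<in> ?inc ` {b \<in> ?P'. Suc (vdegree I b) = k}"
          using a eq deg tight_coparking_contract_iff[OF ei True] by (metis (mono_tags, lifting) image_eqI mem_Collect_eq)
      qed (use deg tight_coparking_contract_iff[OF ei True] in auto)
      moreover have "inj ?inc"
        by (rule injI) (metis fun_upd_apply fun_upd_triv fun_upd_upd nat.inject)
      ultimately have contracted: "card {a \<in> ?P. a i > 0 \<and> vdegree I a = k}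
          = card {b \<in> ?P'. Suc (vdegree I b) = k}" for k
        by (simp add: card_image inj_on_subset)
      have "int (card {b \<in> ?P'. Suc (vdegree I b) = k})
          = (if k = 0 then 0 else h_coeff (E - {e}) (contract_rank r e) (k - 1))" for k
        using IH_contract by (cases k) (auto simp: has_degree_sequence_def)
      then show ?thesis
        using h_coeff_deletion_contraction[OF priv(1) True priv(5)]
        by (simp add: has_degree_sequence_def split deleted contracted)
    next
      case loop: False
      have "r {e} = 0" using rank_le_card[of "{e}"] priv(1) loop by simp
      moreover have "card {a \<in> ?P. a i > 0 \<and> vdegree I a = k} = 0" for k
        using tight_coparking_private_loop[OF ei loop] by (auto simp: card_eq_0_iff)
      ultimately show ?thesis
        using h_coeff_delete_loop[OF priv(1)]
        by (simp add: has_degree_sequence_def split deleted)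
    qed
  qed
qed


section \<open>The rank function of a matroid and its fundamental circuits\<close>

context matroid
begin

lemma finite_indep: "Y \<in> indeps M \<Longrightarrow> finite Y"
  by (rule finite_subset[OF indeps_subset finite_ground])

lemma finite_indeps_in: "finite {Y \<in> indeps M. Y \<subseteq> X}"
proof (rule finite_subset)
  show "{Y \<in> indeps M. Y \<subseteq> X} \<subseteq> Pow (ground M)" using indeps_subset by blast
qed (simp add: finite_ground)

lemma card_le_rank: "Y \<in> indeps M \<Longrightarrow> Y \<subseteq> X \<Longrightarrow> card Y \<le> rank M X"
  unfolding rank_def using finite_indeps_in by (intro Max_ge) auto

lemma rank_attained:
  obtains Y where "Y \<in> indeps M" "Y \<subseteq> X" "card Y = rank M X"
proof -
  have "rank M X \<in> card ` {Y \<in> indeps M. Y \<subseteq> X}"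
    unfolding rank_def using finite_indeps_in empty_indep by (intro Max_in) auto
  then show thesis using that by auto
qed

text \<open>A largest independent set between \<open>Z\<close> and \<open>X\<close> can be augmented as long as it is smaller than an
  independent subset of \<open>X\<close> of maximal size.\<close>

lemma extend_independent:
  assumes "Z \<in> indeps M" "Z \<subseteq> X"
  obtains B where "B \<in> indeps M" "Z \<subseteq> B" "B \<subseteq> X" "card B = rank M X"
proof -
  let ?F = "\<lambda>B. B \<in> indeps M \<and> Z \<subseteq> B \<and> B \<subseteq> X"
  have "\<forall>B. ?F B \<longrightarrow> card B < Suc (rank M X)"
    using card_le_rank by (simp add: less_Suc_eq_le)
  then obtain B where "?F B" "\<forall>B'. ?F B' \<longrightarrow> card B' \<le> card B"
    using ex_has_greatest_nat[of ?F Z card "Suc (rank M X)"] assms by blast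
  then have B: "B \<in> indeps M" "Z \<subseteq> B" "B \<subseteq> X" "\<And>B'. ?F B' \<Longrightarrow> card B' \<le> card B"
    by simp_all
  have "rank M X \<le> card B"
  proof (rule ccontr)
    assume neg: "\<not> ?thesis"
    obtain Y where Y: "Y \<in> indeps M" "Y \<subseteq> X" "card Y = rank M X" by (rule rank_attained)
    then obtain y where y: "y \<in> Y - B" "insert y B \<in> indeps M"
      using augment[OF B(1) Y(1)] neg by auto
    then have "card (insert y B) \<le> card B"
      using B(2,3) Y(2) by (intro B(4)) auto
    then show False using y(1) finite_indep[OF B(1)] by simp
  qed
  then have "card B = rank M X" using card_le_rank[OF B(1,3)] by simp
  then show thesis using that B(1-3) by blast
qed

lemma indep_iff_rank: "X \<subseteq> ground M \<Longrightarrow> X \<in> indeps M \<longleftrightarrow> rank M X = card X"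
proof
  assume ind: "X \<in> indeps M"
  obtain B where "B \<in> indeps M" "X \<subseteq> B" "B \<subseteq> X" "card B = rank M X"
    using extend_independent[OF ind subset_refl] .
  then show "rank M X = card X" by (metis subset_antisym)
next
  assume X: "X \<subseteq> ground M" and eq: "rank M X = card X"
  obtain Y where Y: "Y \<in> indeps M" "Y \<subseteq> X" "card Y = rank M X" by (rule rank_attained)
  then have "Y = X"
    using eq by (intro card_subset_eq[OF finite_subset[OF X finite_ground]]) simp_all
  then show "X \<in> indeps M" using Y(1) by simp
qed

sublocale rank_function "ground M" "rank M"
proof
  show "finite (ground M)" by (rule finite_ground)
  fix X assume X: "X \<subseteq> ground M"
  obtain Y where "Y \<subseteq> X" "card Y = rank M X" by (rule rank_attained)
  then show "rank M X \<le> card X"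
    using finite_subset[OF X finite_ground] by (metis card_mono)
next
  fix X Y :: "'a set" assume "X \<subseteq> Y"
  obtain Z where "Z \<in> indeps M" "Z \<subseteq> X" "card Z = rank M X" by (rule rank_attained)
  then show "rank M X \<le> rank M Y"
    using card_le_rank[of Z Y] \<open>X \<subseteq> Y\<close> by auto
next
  fix X Y assume "X \<subseteq> ground M" "Y \<subseteq> ground M"
  obtain B1 where B1: "B1 \<in> indeps M" "B1 \<subseteq> X \<inter> Y" "card B1 = rank M (X \<inter> Y)"
    by (rule rank_attained)
  then obtain B where B: "B \<in> indeps M" "B1 \<subseteq> B" "B \<subseteq> X \<union> Y" "card B = rank M (X \<union> Y)"
    using extend_independent[of B1 "X \<union> Y"] by auto
  note fin = finite_indep[OF B(1)]
  have "card B + card B1 \<le> card ((B \<inter> X) \<union> (B \<inter> Y)) + card ((B \<inter> X) \<inter> (B \<inter> Y))"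
    using B B1 fin by (intro add_mono card_mono) auto
  also have "\<dots> = card (B \<inter> X) + card (B \<inter> Y)"
    using fin by (intro card_Un_Int[symmetric]) auto
  also have "\<dots> \<le> rank M X + rank M Y"
    using B(1) by (intro add_mono card_le_rank) (auto intro: indep_mono)
  finally show "rank M (X \<union> Y) + rank M (X \<inter> Y) \<le> rank M X + rank M Y"
    using B(4) B1(3) by simp
qed

lemma circuit_rank:
  assumes "circuit M D" and "f \<in> D"
  shows "Suc (rank M D) = card D" and "rank M (D - {f}) = rank M D"
proof -
  have D: "D \<subseteq> ground M" "D \<notin> indeps M" and ind: "D - {f} \<in> indeps M"
    using assms by (auto simp: circuit_def dependent_def)
  have "rank M (D - {f}) = card (D - {f})"
    using ind indep_iff_rank indeps_subset by blast
  moreover have "Suc (card (D - {f})) = card D"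
    using card.remove[OF finite_sub[OF D(1)] assms(2)] by simp
  moreover have "rank M D < card D"
    using rank_le_card[OF D(1)] D indep_iff_rank[OF D(1)] by linarith
  moreover have "rank M (D - {f}) \<le> rank M D"
    using D(1) by (intro rank_mono) auto
  ultimately show "Suc (rank M D) = card D" "rank M (D - {f}) = rank M D" by linarith+
qed

lemma circuit_exists:
  assumes "X \<subseteq> ground M" and "X \<notin> indeps M"
  obtains D where "circuit M D" "D \<subseteq> X"
proof -
  have "finite X" using assms(1) by (rule finite_sub)
  then have "X \<notin> indeps M \<longrightarrow> X \<subseteq> ground M \<longrightarrow> (\<exists>D. circuit M D \<and> D \<subseteq> X)"
  proof (induction X rule: finite_psubset_induct)
    case (psubset X)
    show ?case
    proof (cases "\<forall>Y. Y \<subset> X \<longrightarrow> Y \<in> indeps M")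
      case False
      then obtain Y where "Y \<subset> X" "Y \<notin> indeps M" by blast
      then show ?thesis using psubset.IH[of Y] by blast
    qed (auto simp: circuit_def dependent_def)
  qed
  then show thesis using assms that by blast
qed

text \<open>Two distinct circuits \<open>D\<close>, \<open>D'\<close> in \<open>insert i B\<close> would both contain \<open>i\<close>, so their union would have
  nullity at most \<open>1\<close>, its part outside \<open>i\<close> being independent.  Since \<open>D \<inter> D'\<close> is independent,
  submodularity gives the union nullity at least \<open>2\<close>.\<close>

lemma fund_circuit:
  assumes B: "basis M B" and i: "i \<in> ground M - B"
  shows "circuit M (fund_circuit M B i)" and "fund_circuit M B i \<subseteq> insert i B"
    and "i \<in> fund_circuit M B i"
proof -
  have Bind: "B \<in> indeps M" using B by (simp add: basis_def)
  have Bg: "insert i B \<subseteq> ground M" using indeps_subset[OF Bind] i by auto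
  have dep: "insert i B \<notin> indeps M" using B i unfolding basis_def by blast
  have mem: "i \<in> D" if "circuit M D" "D \<subseteq> insert i B" for D
  proof (rule ccontr)
    assume "i \<notin> D"
    then have "D \<in> indeps M" using that(2) by (intro indep_mono[OF Bind]) auto
    then show False using that(1) by (simp add: circuit_def dependent_def)
  qed
  have unique: "D = D'" if D: "circuit M D" "D \<subseteq> insert i B" and D': "circuit M D'" "D' \<subseteq> insert i B" for D D'
  proof (rule ccontr)
    assume neq: "D \<noteq> D'"
    have "\<not> D \<subset> D'" using D(1) D'(1) unfolding circuit_def dependent_def by blast
    then have "D \<inter> D' \<subset> D" using neq by blast
    then have "D \<inter> D' \<in> indeps M" using D(1) unfolding circuit_def by blast
    moreover have g: "D \<subseteq> ground M" "D' \<subseteq> ground M" "D \<union> D' \<subseteq> ground M" "D \<inter> D' \<subseteq> ground M"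
      using D D' Bg by auto
    ultimately have cap: "rank M (D \<inter> D') = card (D \<inter> D')" using indep_iff_rank by simp
    have "D \<union> D' - {i} \<in> indeps M" using D D' by (intro indep_mono[OF Bind]) auto
    then have "card (D \<union> D' - {i}) \<le> rank M (D \<union> D')" by (intro card_le_rank) auto
    moreover have "card (D \<union> D') = Suc (card (D \<union> D' - {i}))"
      using mem[OF D] finite_sub[OF g(3)] by (intro card.remove) auto
    moreover have "rank M (D \<union> D') + rank M (D \<inter> D') \<le> rank M D + rank M D'"
      using g by (intro rank_submod)
    moreover have "card D + card D' = card (D \<union> D') + card (D \<inter> D')"
      using g finite_sub by (intro card_Un_Int) auto
    ultimately show False
      using cap circuit_rank(1)[OF D(1) mem[OF D]] circuit_rank(1)[OF D'(1) mem[OF D']] by linarith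
  qed
  obtain D where "circuit M D" "D \<subseteq> insert i B" using circuit_exists[OF Bg dep] .
  then have "\<exists>!D. circuit M D \<and> D \<subseteq> insert i B" using unique by blast
  then have "circuit M (fund_circuit M B i) \<and> fund_circuit M B i \<subseteq> insert i B"
    unfolding fund_circuit_def by (rule theI')
  then show "circuit M (fund_circuit M B i)" "fund_circuit M B i \<subseteq> insert i B"
    "i \<in> fund_circuit M B i"
    using mem by auto
qed

lemma rank_restriction_basis:
  assumes "basis (restriction M A) U"
  shows "rank M A = card U"
proof -
  have U: "U \<in> indeps M" "U \<subseteq> A" and max: "\<And>X. X \<in> indeps M \<Longrightarrow> X \<subseteq> A \<Longrightarrow> U \<subseteq> X \<Longrightarrow> X = U"
    using assms by (auto simp: basis_def restriction_def)
  obtain B where "B \<in> indeps M" "U \<subseteq> B" "B \<subseteq> A" "card B = rank M A"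
    using extend_independent[OF U] .
  then show ?thesis using max[of B] by simp
qed

lemma rank_basis: "basis M B \<Longrightarrow> rank M (ground M) = card B"
  by (rule rank_restriction_basis) (use indeps_subset in \<open>simp add: basis_def restriction_def\<close>)

text \<open>The covered part of \<open>B\<close> is a basis of \<open>A_set (fund_circuit M B) S\<close>: an element of \<open>S\<close> added to it
  completes a fundamental circuit.\<close>

lemma nullity_fund_circuits:
  assumes B: "basis M B" and S: "S \<subseteq> ground M - B"
  shows "card S \<le> nullity (rank M) (A_set (fund_circuit M B) S)"
proof -
  let ?A = "A_set (fund_circuit M B) S"
  have fc: "circuit M (fund_circuit M B i)" "fund_circuit M B i \<subseteq> insert i B"
    "i \<in> fund_circuit M B i" if "i \<in> S" for i
    using fund_circuit[OF B, of i] that S by auto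
  have Bind: "B \<in> indeps M" using B by (simp add: basis_def)
  have A: "?A \<subseteq> ground M"
    using fc(1) by (auto simp: A_set_def circuit_def dependent_def)
  have eq: "?A = S \<union> (?A \<inter> B)" using fc(2,3) by (auto simp: A_set_def)
  have "rank M ?A \<le> card (?A \<inter> B)"
  proof (rule ccontr)
    assume neg: "\<not> ?thesis"
    obtain Y where Y: "Y \<in> indeps M" "Y \<subseteq> ?A" "card Y = rank M ?A" by (rule rank_attained)
    have "?A \<inter> B \<in> indeps M" using Bind by (rule indep_mono) auto
    then obtain y where y: "y \<in> Y - ?A \<inter> B" "insert y (?A \<inter> B) \<in> indeps M"
      using augment[of "?A \<inter> B" Y] Y neg by auto
    then have "y \<in> S" using Y(2) eq by blast
    then have "fund_circuit M B y \<subseteq> insert y (?A \<inter> B)"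
      using fc(2)[of y] by (auto simp: A_set_def)
    then have "fund_circuit M B y \<in> indeps M" by (rule indep_mono[OF y(2)])
    then show False using fc(1)[OF \<open>y \<in> S\<close>] by (simp add: circuit_def dependent_def)
  qed
  moreover have "card ?A = card S + card (?A \<inter> B)"
  proof -
    have "finite ?A" using A by (rule finite_sub)
    then show ?thesis
      using card_Un_disjoint[of S "?A \<inter> B"] eq S by (metis Diff_disjoint disjoint_iff finite_Un subsetD Int_iff DiffD2)
  qed
  ultimately show ?thesis by (simp add: nullity_def)
qed

lemma spanning_family_fund_circuits:
  assumes B: "basis M B"
    and gen: "\<And>S. stratum (ground M - B) S \<Longrightarrow> U_set (fund_circuit M B) S \<in> indeps M \<Longrightarrow>
      basis (restriction M (A_set (fund_circuit M B) S)) (U_set (fund_circuit M B) S)"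
  shows "spanning_family (ground M) (rank M) (ground M - B) (fund_circuit M B)"
proof
  let ?C = "fund_circuit M B"
  have Cg: "?C i \<subseteq> ground M" if "i \<in> ground M - B" for i
    using fund_circuit(1)[OF B that] by (simp add: circuit_def dependent_def)
  show "finite (ground M - B)" using finite_ground by simp
  show "?C i \<subseteq> ground M" if "i \<in> ground M - B" for i by (rule Cg[OF that])
  show "rank M (ground M) + card (ground M - B) = card (ground M)"
  proof -
    have "B \<subseteq> ground M" using B indeps_subset by (simp add: basis_def)
    then show ?thesis
      using rank_basis[OF B] finite_sub[of B] card_mono[OF finite_ground, of B] by (simp add: card_Diff_subset)
  qed
  show "rank M (?C i - {f}) = rank M (?C i)" if "i \<in> ground M - B" "f \<in> ?C i" for i f
    by (rule circuit_rank(2)[OF fund_circuit(1)[OF B that(1)] that(2)])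
  show "card S \<le> nullity (rank M) (A_set ?C S)" if "S \<subseteq> ground M - B" for S
    by (rule nullity_fund_circuits[OF B that])
  show "rank M (A_set ?C S) = rank M (U_set ?C S)"
    if S: "S \<subseteq> ground M - B" "S \<noteq> {}" and ind: "rank M (U_set ?C S) = card (U_set ?C S)" for S
  proof -
    have "A_set ?C S \<subseteq> ground M" using Cg S(1) by (auto simp: A_set_def)
    then have "U_set ?C S \<subseteq> ground M" by (rule order_trans[OF U_set_subset_A_set])
    then have "U_set ?C S \<in> indeps M" using ind indep_iff_rank by blast
    then show ?thesis
      using rank_restriction_basis[OF gen[of S]] S ind by (simp add: stratum_def)
  qed
qed

lemma h_vector_eq: "h_vector M = h_coeff (ground M) (rank M)"
  using finite_ground rank_le_card by (rule h_vector_eq_h_coeff)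

text \<open>Contracting a set that spans \<open>A_set (fund_circuit M B) \<sigma>\<close> leaves only loops.\<close>

lemma h_vector_K_matroid:
  assumes dead: "\<sigma> \<in> dead_strata M B"
    and span: "rank M (A_set (fund_circuit M B) \<sigma>) = card (U_set (fund_circuit M B) \<sigma>)"
    and A: "A_set (fund_circuit M B) \<sigma> \<subseteq> ground M"
  shows "h_vector (K_matroid M B \<sigma>) k = (if k = 0 then 1 else 0)"
proof -
  let ?A = "A_set (fund_circuit M B) \<sigma>" and ?U = "U_set (fund_circuit M B) \<sigma>"
  let ?K = "K_matroid M B \<sigma>"
  have U: "?U \<subseteq> ?A" by (rule U_set_subset_A_set)
  have rank_restr: "rank (restriction M ?A) X = rank M X" if "X \<subseteq> ?A" for X
  proof -
    have "{Y \<in> {X \<in> indeps M. X \<subseteq> ?A}. Y \<subseteq> X} = {Y \<in> indeps M. Y \<subseteq> X}" using that by auto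
    then show ?thesis by (simp add: rank_def restriction_def)
  qed
  have ground_K: "ground ?K = ?A - ?U"
    using A by (auto simp: K_matroid_def contraction_def restriction_def)
  have rank_U: "rank M ?U = card ?U"
    using dead indep_iff_rank[of ?U] U A by (auto simp: dead_strata_def)
  have "indeps ?K = {{}}"
  proof -
    have "X = {}" if X: "X \<subseteq> ?A - ?U" "rank M (X \<union> ?U) = rank M ?U + card X" for X
    proof -
      have "rank M (X \<union> ?U) \<le> rank M ?A" using X(1) U A by (intro rank_mono) auto
      then have "card X = 0" using X(2) span rank_U by simp
      moreover have "finite X" using X(1) finite_sub[OF A] finite_subset by blast
      ultimately show ?thesis by simp
    qed
    moreover have "rank (restriction M ?A) (X \<union> ?U) = rank M (X \<union> ?U)" if "X \<subseteq> ?A - ?U" for X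
      using that U by (intro rank_restr) auto
    moreover have "rank (restriction M ?A) ?U = rank M ?U" using U by (rule rank_restr)
    moreover have "ground (restriction M ?A) = ?A" using A by (auto simp: restriction_def)
    ultimately have "X \<in> indeps ?K \<longleftrightarrow> X = {}" for X
      unfolding K_matroid_def contraction_def by (cases "X = {}") auto
    then show ?thesis by blast
  qed
  then have rank_K: "rank ?K X = 0" for X
    by (simp add: rank_def Collect_conv_if)
  interpret K: rank_function "ground ?K" "rank ?K"
    by unfold_locales (use finite_sub[OF A] in \<open>auto simp: ground_K rank_K\<close>)
  have "h_vector ?K = h_coeff (ground ?K) (rank ?K)"
    using K.finite_E K.rank_le_card by (rule h_vector_eq_h_coeff)
  then show ?thesis
    using K.h_coeff_loops_and_coloops[OF subset_refl rank_K, of k] by (simp add: rank_K)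
qed

end

section \<open>Fibre systems\<close>

lemma singleton_of_degree_sequence:
  assumes "finite V" and "X \<subseteq> vectors V" and "finite X"
    and "has_degree_sequence V X (\<lambda>k. if k = 0 then 1 else 0)"
  shows "X = {\<lambda>_. 0}"
proof -
  have zero: "a = (\<lambda>_. 0)" if "a \<in> X" for a
  proof -
    have "card {b \<in> X. vdegree V b = vdegree V a} > 0"
      using that assms(3) by (auto simp: card_gt_0_iff)
    then have "vdegree V a = 0"
      using assms(4) unfolding has_degree_sequence_def by (metis of_nat_0 of_nat_eq_iff less_numeral_extra(3))
    then have "\<forall>i\<in>V. a i = 0" using assms(1) by (simp add: vdegree_def)
    then show ?thesis using that assms(2) by (auto simp: vectors_def fun_eq_iff)
  qed
  moreover have "X \<noteq> {}"
    using assms(4) by (auto simp: has_degree_sequence_def split: if_splits)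
  ultimately show ?thesis by blast
qed

text \<open>The only candidate for a fibre system once all \<open>K\<^sub>\<sigma>\<close> have rank \<open>0\<close>.\<close>

definition zero_fibres :: "'a matroid_data \<Rightarrow> 'a set \<Rightarrow> ('a set \<rightharpoonup> ('a \<Rightarrow> nat) set)" where
  "zero_fibres M B \<sigma> = (if \<sigma> \<in> dead_strata M B then Some {\<lambda>_. 0} else None)"

text \<open>The truncated difference vanishes as soon as \<open>a \<le> b\<^sub>\<tau>\<close> on \<open>\<tau>\<close>; firing supplies the other inequality.\<close>

lemma passes_zero_fibres_iff:
  assumes "can_fire (fund_circuit M B) \<tau> a"
  shows "passes M B (zero_fibres M B) \<tau> a \<longleftrightarrow>
    \<tau> \<in> dead_strata M B \<and> restr \<tau> a = baseline (fund_circuit M B) \<tau>"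
proof (cases "\<tau> \<in> dead_strata M B")
  case True
  have "baseline (fund_circuit M B) \<tau> \<le> restr \<tau> a"
    using assms by (auto simp: can_fire_def baseline_def restr_def le_fun_def)
  then have "(\<lambda>i. restr \<tau> a i - baseline (fund_circuit M B) \<tau> i) = (\<lambda>_. 0) \<longleftrightarrow>
      restr \<tau> a = baseline (fund_circuit M B) \<tau>"
    by (auto simp: fun_eq_iff le_fun_def intro: antisym)
  then show ?thesis using True by (simp add: passes_def zero_fibres_def)
qed (simp add: passes_def)

locale spanning_fund_circuits = matroid M + sf: spanning_family "ground M" "rank M" "ground M - B" "fund_circuit M B"
  for M :: "'a matroid_data" and B :: "'a set"
begin

abbreviation "R \<equiv> ground M - B"
abbreviation "C \<equiv> fund_circuit M B"

lemma dead_iff: "\<tau> \<in> dead_strata M B \<longleftrightarrow> stratum R \<tau> \<and> rank M (U_set C \<tau>) = card (U_set C \<tau>)"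
proof (cases "stratum R \<tau>")
  case True
  then have "U_set C \<tau> \<subseteq> ground M" by (intro sf.U_set_subset) (simp add: stratum_def)
  then show ?thesis using indep_iff_rank by (simp add: dead_strata_def)
qed (simp add: dead_strata_def)

lemma coparking_zero_fibres: "coparking_fibre M B (zero_fibres M B) = tight_coparking (rank M) R C"
proof -
  have "stratum R \<tau> \<and> can_fire C \<tau> a \<longrightarrow>
      (passes M B (zero_fibres M B) \<tau> a \<longleftrightarrow> rank M (U_set C \<tau>) = card (U_set C \<tau>) \<and> restr \<tau> a = baseline C \<tau>)"
    for \<tau> a
    using passes_zero_fibres_iff[of M B \<tau> a] dead_iff[of \<tau>] by blast
  then show ?thesis
    unfolding coparking_fibre_def tight_coparking_def by blast
qed

lemma h_vector_dead:
  assumes "\<sigma> \<in> dead_strata M B"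
  shows "h_vector (K_matroid M B \<sigma>) = (\<lambda>k. if k = 0 then 1 else 0)"
proof -
  have "\<sigma> \<subseteq> R" "\<sigma> \<noteq> {}" "rank M (U_set C \<sigma>) = card (U_set C \<sigma>)"
    using assms dead_iff by (auto simp: stratum_def)
  then show ?thesis
    using h_vector_K_matroid[OF assms] sf.spanning sf.A_set_subset by (simp add: fun_eq_iff)
qed

text \<open>Baselines decrease as strata grow, so a stratum \<open>\<tau> \<subset> \<sigma>\<close> fired from \<open>b\<^sub>\<sigma>\<close> is fired exactly at its
  own baseline.  Then \<open>C i \<inter> U\<^sub>\<tau> = C i \<inter> U\<^sub>\<sigma>\<close> for \<open>i \<in> \<tau>\<close>, so that \<open>U\<^sub>\<tau> \<subseteq> U\<^sub>\<sigma>\<close> is independent.\<close>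

lemma fibre_at_zero_fibres:
  assumes dead: "\<sigma> \<in> dead_strata M B"
  shows "fibre_at M B (zero_fibres M B) \<sigma> {\<lambda>_. 0}"
  unfolding fibre_at_def
proof (intro conjI ballI allI impI)
  have \<sigma>: "\<sigma> \<subseteq> R" using dead by (simp add: dead_iff stratum_def)
  have "b = (\<lambda>_. 0)" if "b \<le> (\<lambda>_. 0)" for b :: "'a \<Rightarrow> nat"
    using that by (auto simp: le_fun_def)
  then show "pure_multicomplex \<sigma> {\<lambda>_. 0}"
    unfolding pure_multicomplex_def multicomplex_def maximal_in_def vectors_def by auto
  show "has_degree_sequence \<sigma> {\<lambda>_. 0} (h_vector (K_matroid M B \<sigma>))"
    by (simp add: has_degree_sequence_def h_vector_dead[OF dead] vdegree_def Collect_conv_if)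
  fix m \<tau> assume m: "m \<in> {\<lambda>_. 0}"
    and \<tau>: "stratum R \<tau> \<and> \<tau> \<subset> \<sigma> \<and> can_fire C \<tau> (\<lambda>i. baseline C \<sigma> i + m i)"
  have m0: "(\<lambda>i. baseline C \<sigma> i + m i) = baseline C \<sigma>" using m by simp
  have eq: "C i \<inter> U_set C \<sigma> = C i \<inter> U_set C \<tau>" if i: "i \<in> \<tau>" for i
  proof (rule card_seteq)
    have "i \<in> \<sigma>" "i \<in> R" using i \<tau> \<sigma> by auto
    show "finite (C i \<inter> U_set C \<tau>)" using sf.finite_C[OF \<open>i \<in> R\<close>] by simp
    show "C i \<inter> U_set C \<sigma> \<subseteq> C i \<inter> U_set C \<tau>"
      using i \<tau> by (intro U_set_private_antimono) auto
    have "card (C i \<inter> U_set C \<tau>) \<le> baseline C \<sigma> i"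
      using \<tau> i unfolding m0 can_fire_iff by blast
    then show "card (C i \<inter> U_set C \<tau>) \<le> card (C i \<inter> U_set C \<sigma>)"
      using \<open>i \<in> \<sigma>\<close> by (simp add: baseline_def restr_def)
  qed
  have "U_set C \<tau> \<subseteq> U_set C \<sigma>"
  proof
    fix x assume x: "x \<in> U_set C \<tau>"
    then obtain i where "i \<in> \<tau>" "x \<in> C i" unfolding mem_U_set_iff by blast
    then show "x \<in> U_set C \<sigma>" using eq[of i] x by blast
  qed
  then have "\<tau> \<in> dead_strata M B"
    using dead \<tau> indep_mono by (auto simp: dead_strata_def)
  moreover have "restr \<tau> (baseline C \<sigma>) = baseline C \<tau>"
    unfolding restr_eq_baseline_iff using eq \<tau> by (auto simp: baseline_def restr_def)
  ultimately show "passes M B (zero_fibres M B) \<tau> (\<lambda>i. baseline C \<sigma> i + m i)"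
    using passes_zero_fibres_iff[of M B \<tau> "baseline C \<sigma>"] \<tau> unfolding m0 by blast
qed

lemma fibre_system_iff: "fibre_system M B G \<longleftrightarrow> G = zero_fibres M B"
proof
  assume G: "fibre_system M B G"
  show "G = zero_fibres M B"
  proof
    fix \<sigma>
    show "G \<sigma> = zero_fibres M B \<sigma>"
    proof (cases "\<sigma> \<in> dead_strata M B")
      case True
      then have \<sigma>: "\<sigma> \<subseteq> R" by (simp add: dead_iff stratum_def)
      have "fibre_at M B G \<sigma> (the (G \<sigma>))" using G True by (simp add: fibre_system_def)
      then have "the (G \<sigma>) = {\<lambda>_. 0}"
        using finite_subset[OF \<sigma> sf.finite_I] h_vector_dead[OF True]
        by (intro singleton_of_degree_sequence[of \<sigma>])
          (auto simp: fibre_at_def pure_multicomplex_def multicomplex_def)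
      moreover have "\<sigma> \<in> dom G" using G True by (simp add: fibre_system_def)
      ultimately show ?thesis using True by (auto simp: zero_fibres_def)
    next
      case False
      then have "\<sigma> \<notin> dom G" using G by (simp add: fibre_system_def)
      then show ?thesis using False by (auto simp: zero_fibres_def)
    qed
  qed
next
  assume "G = zero_fibres M B"
  then show "fibre_system M B G"
    using fibre_at_zero_fibres by (auto simp: fibre_system_def zero_fibres_def dom_def)
qed

lemma coparking_zero_fibres_pure:
  shows "pure_multicomplex R (coparking_fibre M B (zero_fibres M B))"
    and "has_degree_sequence R (coparking_fibre M B (zero_fibres M B)) (h_vector M)"
  unfolding coparking_zero_fibres h_vector_eq
  using sf.pure_tight_coparking degree_sequence_tight_coparking[OF sf.spanning_family_axioms]
  by simp_all

lemma coparking_zero_fibres_explicit: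
  "coparking_fibre M B (zero_fibres M B) = {a \<in> vectors R.
     (\<forall>\<sigma> \<in> live_strata M B. \<not> can_fire C \<sigma> a) \<and>
     (\<forall>\<tau> \<in> dead_strata M B. can_fire C \<tau> a \<longrightarrow> restr \<tau> a = baseline C \<tau>)}"
proof -
  have "stratum R \<tau> \<longleftrightarrow> \<tau> \<in> live_strata M B \<or> \<tau> \<in> dead_strata M B" for \<tau>
    by (auto simp: live_strata_def dead_strata_def)
  moreover have "\<tau> \<notin> dead_strata M B" if "\<tau> \<in> live_strata M B" for \<tau>
    using that by (auto simp: live_strata_def dead_strata_def)
  ultimately show ?thesis
    unfolding coparking_fibre_def using passes_zero_fibres_iff[of M B] by blast
qed

end

theorem corollary4p27:
  fixes M :: "'a matroid_data" and B0 R :: "'a set" and C :: "'a \<Rightarrow> 'a set"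
  assumes "matroid M"
    and "basis M B0"
  defines "R \<equiv> ground M - B0"
    and "C \<equiv> fund_circuit M B0"
  shows
    "(cycle_system M R C \<longrightarrow>
        dead_strata M B0 = {} \<and>
        {F. fibre_system M B0 F} = {Map.empty} \<and>
        coparking_fibre M B0 Map.empty = coparking R C \<and>
        pure_multicomplex R (coparking_fibre M B0 Map.empty) \<and>
        has_degree_sequence R (coparking_fibre M B0 Map.empty) (h_vector M))
     \<and>
     (generalized_cycle_system M R C \<longrightarrow>
        (\<exists>F. {G. fibre_system M B0 G} = {F} \<and>
          (\<forall>\<sigma> \<in> dead_strata M B0. F \<sigma> = Some {\<lambda>_. 0}) \<and>
          coparking_fibre M B0 F =
            {a \<in> vectors R.
               (\<forall>\<sigma> \<in> live_strata M B0. \<not> can_fire C \<sigma> a) \<and>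
               (\<forall>\<tau> \<in> dead_strata M B0. can_fire C \<tau> a \<longrightarrow> restr \<tau> a = baseline C \<tau>)} \<and>
          pure_multicomplex R (coparking_fibre M B0 F) \<and>
          has_degree_sequence R (coparking_fibre M B0 F) (h_vector M)))"
proof -
  interpret matroid M by fact
  have family: "spanning_fund_circuits M B0" if "generalized_cycle_system M R C"
  proof -
    have "spanning_family (ground M) (rank M) (ground M - B0) (fund_circuit M B0)"
    proof (rule spanning_family_fund_circuits[OF \<open>basis M B0\<close>])
      fix S assume "stratum (ground M - B0) S" "U_set (fund_circuit M B0) S \<in> indeps M"
      then show "basis (restriction M (A_set (fund_circuit M B0) S)) (U_set (fund_circuit M B0) S)"
        using that unfolding generalized_cycle_system_def dependent_def stratum_def A_set_def R_def C_def
        by blast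
    qed
    then show ?thesis
      by (intro spanning_fund_circuits.intro \<open>matroid M\<close>)
  qed
  show ?thesis
  proof (intro conjI impI)
    assume cyc: "cycle_system M R C"
    then have "generalized_cycle_system M R C"
      by (simp add: cycle_system_def generalized_cycle_system_def)
    then interpret spanning_fund_circuits M B0 by (rule family)
    have no_dead: "dead_strata M B0 = {}"
      using cyc unfolding cycle_system_def dependent_def dead_strata_def stratum_def R_def C_def by blast
    then have empty: "zero_fibres M B0 = Map.empty"
      by (simp add: zero_fibres_def fun_eq_iff)
    show "dead_strata M B0 = {}" by (rule no_dead)
    show "{F. fibre_system M B0 F} = {Map.empty}"
      by (simp add: fibre_system_iff empty)
    show "coparking_fibre M B0 Map.empty = coparking R C"
      by (auto simp: coparking_fibre_def coparking_def passes_def no_dead R_def C_def)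
    show "pure_multicomplex R (coparking_fibre M B0 Map.empty)"
      "has_degree_sequence R (coparking_fibre M B0 Map.empty) (h_vector M)"
      using coparking_zero_fibres_pure by (simp_all add: empty R_def)
  next
    assume "generalized_cycle_system M R C"
    then interpret spanning_fund_circuits M B0 by (rule family)
    show "\<exists>F. {G. fibre_system M B0 G} = {F} \<and>
          (\<forall>\<sigma> \<in> dead_strata M B0. F \<sigma> = Some {\<lambda>_. 0}) \<and>
          coparking_fibre M B0 F =
            {a \<in> vectors R.
               (\<forall>\<sigma> \<in> live_strata M B0. \<not> can_fire C \<sigma> a) \<and>
               (\<forall>\<tau> \<in> dead_strata M B0. can_fire C \<tau> a \<longrightarrow> restr \<tau> a = baseline C \<tau>)} \<and>
          pure_multicomplex R (coparking_fibre M B0 F) \<and>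
          has_degree_sequence R (coparking_fibre M B0 F) (h_vector M)"
      using coparking_zero_fibres_pure coparking_zero_fibres_explicit
      by (intro exI[of _ "zero_fibres M B0"]) (simp add: fibre_system_iff zero_fibres_def R_def C_def)
  qed
qed

end
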